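(* Let $\mathfrak{D}$ be a class of small categories containing the terminal category $\mathsf{1}$, and let $\mathcal{A}$, $\mathcal{B}$ be locally small categories. If $G\colon\mathcal{A}\to\mathcal{B}$ is a right $\mathfrak{D}$-pro-adjoint and $\mathcal{B}$ is $\mathfrak{D}$-complete, then $G$ has a codensity monad and it is the monad induced by the right adjoint $$\mathsf{Pro}(\mathfrak{D},\mathcal{A})\xrightarrow{\ \mathsf{Pro}(\mathfrak{D},G)\ }\mathsf{Pro}(\mathfrak{D},\mathcal{B})\longrightarrow\mathcal{B},$$ where the second functor is the right adjoint of the inclusion $\mathcal{B}\hookrightarrow\mathsf{Pro}(\mathfrak{D},\mathcal{B})$.
   Context: A functor $\mathcal{A}\to\mathsf{Set}$ is small if it is a small colimit of representables; $[\mathcal{A},\mathsf{Set}]_{\mathsf{s}}$ is the category of small functors, so that $[\mathcal{A},\mathsf{Set}]_{\mathsf{s}}^{\mathrm{op}}$ is the free small-limit completion of $\mathcal{A}$ via the Yoneda embedding. $\mathsf{Pro}(\mathfrak{D},\mathcal{A})$ is the full subcategory of $[\mathcal{A},\mathsf{Set}]_{\mathsf{s}}^{\mathrm{op}}$ on those objects that are $\mathcal{I}^{\mathrm{op}}$-indexed limits of representables for some $\mathcal{I}\in\mathfrak{D}$. Since $\mathsf{1}\in\mathfrak{D}$, the Yoneda embedding corestricts to a full and faithful functor $\mathcal{A}\hookrightarrow\mathsf{Pro}(\mathfrak{D},\mathcal{A})$. A category is $\mathfrak{D}$-complete if it has $\mathcal{I}^{\mathrm{op}}$-indexed limits for all $\mathcal{I}\in\mathfrak{D}$;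 in that case the inclusion into its $\mathsf{Pro}(\mathfrak{D},-)$ has a right adjoint, sending a formal limit to the actual limit. A functor $G\colon\mathcal{A}\to\mathcal{B}$ induces $\mathsf{Pro}(\mathfrak{D},G)\colon\mathsf{Pro}(\mathfrak{D},\mathcal{A})\to\mathsf{Pro}(\mathfrak{D},\mathcal{B})$, sending the formal limit of $D\colon\mathcal{I}^{\mathrm{op}}\to\mathcal{A}$ to the formal limit of $GD$ (equivalently, the opposite of left Kan extension $P\mapsto\mathrm{Lan}_GP$ of small functors along $G$); it commutes, with $G$, with the inclusions of $\mathcal{A}$ and $\mathcal{B}$. $G$ is a right $\mathfrak{D}$-pro-adjoint if $\mathsf{Pro}(\mathfrak{D},G)$ is a right adjoint. The codensity monad of $G$ is, when it exists, the right Kan extension $(R,\varepsilon\colon RG\to G)$ of $G$ along itself, with the unique monad structure such that $\varepsilon\cdot\eta^RG=1_G$ and $\varepsilon\cdot\mu^RG=\varepsilon\cdot R\varepsilon$; it is determined up to isomorphism of monads. *)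

theory Defs
  imports "HOL-Library.FuncSet" "HOL-Library.Equipollence"
begin

section \<open>Size\<close>

text \<open>
  The elements of the type \<open>'u\<close> play the role of the elements of small sets: a set is small if
  it has fewer elements than \<open>'u\<close>. When the cardinality of \<open>'u\<close> is a strongly inaccessible
  cardinal, these are, up to bijection, the small sets of a Grothendieck universe. Only regularity
  is required of this cardinal.
\<close>

definition small :: "'u itself \<Rightarrow> 'x set \<Rightarrow> bool" where
  "small _ X \<longleftrightarrow> X \<prec> (UNIV :: 'u set)"

definition universe :: "'u itself \<Rightarrow> bool" where
  "universe U \<longleftrightarrow> infinite (UNIV :: 'u set) \<and>
     (\<forall>\<X> :: 'u set set. small U \<X> \<longrightarrow> (\<forall>X\<in>\<X>. small U X) \<longrightarrow> small U (\<Union>\<X>))"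


section \<open>Categories, functors, natural transformations\<close>

text \<open>
  Hom-sets are indexed by source and target and need not be disjoint, so composition takes the
  three objects as arguments: \<open>Comp C a b c g f\<close> is the composite of \<open>f \<in> Hom C a b\<close> followed by
  \<open>g \<in> Hom C b c\<close>. Hence a category with small hom-sets can have all its hom-sets in \<open>'u\<close>, however
  many objects it has.
\<close>

record ('o, 'm) cat =
  Obj :: "'o set"
  Hom :: "'o \<Rightarrow> 'o \<Rightarrow> 'm set"
  Ident :: "'o \<Rightarrow> 'm"
  Comp :: "'o \<Rightarrow> 'o \<Rightarrow> 'o \<Rightarrow> 'm \<Rightarrow> 'm \<Rightarrow> 'm"

definition category :: "('o, 'm) cat \<Rightarrow> bool" where
  "category C \<longleftrightarrow>
     (\<forall>a\<in>Obj C. Ident C a \<in> Hom C a a) \<and>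
     (\<forall>a\<in>Obj C. \<forall>b\<in>Obj C. \<forall>c\<in>Obj C. \<forall>f\<in>Hom C a b. \<forall>g\<in>Hom C b c.
        Comp C a b c g f \<in> Hom C a c) \<and>
     (\<forall>a\<in>Obj C. \<forall>b\<in>Obj C. \<forall>f\<in>Hom C a b.
        Comp C a a b f (Ident C a) = f \<and> Comp C a b b (Ident C b) f = f) \<and>
     (\<forall>a\<in>Obj C. \<forall>b\<in>Obj C. \<forall>c\<in>Obj C. \<forall>d\<in>Obj C.
        \<forall>f\<in>Hom C a b. \<forall>g\<in>Hom C b c. \<forall>h\<in>Hom C c d.
        Comp C a b d (Comp C b c d h g) f = Comp C a c d h (Comp C a b c g f))"

definition locally_small :: "('o, 'u) cat \<Rightarrow> bool" where
  "locally_small C \<longleftrightarrow>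
     category C \<and> (\<forall>a\<in>Obj C. \<forall>b\<in>Obj C. small TYPE('u) (Hom C a b))"

definition small_cat :: "('u, 'u) cat \<Rightarrow> bool" where
  "small_cat C \<longleftrightarrow> locally_small C \<and> small TYPE('u) (Obj C)"

definition terminal_cat :: "('o, 'm) cat \<Rightarrow> bool" where
  "terminal_cat C \<longleftrightarrow> category C \<and> (\<exists>x i. Obj C = {x} \<and> Hom C x x = {i})"

definition op_cat :: "('o, 'm) cat \<Rightarrow> ('o, 'm) cat" where
  "op_cat C = \<lparr>Obj = Obj C, Hom = (\<lambda>a b. Hom C b a), Ident = Ident C,
     Comp = (\<lambda>a b c g f. Comp C c b a f g)\<rparr>"

definition full_subcat :: "('o, 'm) cat \<Rightarrow> ('o \<Rightarrow> bool) \<Rightarrow> ('o, 'm) cat" where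
  "full_subcat C P = C\<lparr>Obj := {x \<in> Obj C. P x}\<rparr>"

text \<open>
  The values of a functor outside its domain are left unconstrained, so one functor may have
  several codes. They are isomorphic in the functor categories below. Natural transformations and
  functions between sets are extensional, so that equality of arrows is what it should be.
\<close>

record ('o, 'm, 'p, 'n) func =
  ob :: "'o \<Rightarrow> 'p"
  ar :: "'o \<Rightarrow> 'o \<Rightarrow> 'm \<Rightarrow> 'n"

definition is_functor :: "('o, 'm) cat \<Rightarrow> ('p, 'n) cat \<Rightarrow> ('o, 'm, 'p, 'n) func \<Rightarrow> bool" where
  "is_functor C D F \<longleftrightarrow> category C \<and> category D \<and>
     (\<forall>a\<in>Obj C. ob F a \<in> Obj D) \<and>
     (\<forall>a\<in>Obj C. \<forall>b\<in>Obj C. \<forall>f\<in>Hom C a b. ar F a b f \<in> Hom D (ob F a) (ob F b)) \<and>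
     (\<forall>a\<in>Obj C. ar F a a (Ident C a) = Ident D (ob F a)) \<and>
     (\<forall>a\<in>Obj C. \<forall>b\<in>Obj C. \<forall>c\<in>Obj C. \<forall>f\<in>Hom C a b. \<forall>g\<in>Hom C b c.
        ar F a c (Comp C a b c g f) =
        Comp D (ob F a) (ob F b) (ob F c) (ar F b c g) (ar F a b f))"

definition id_func :: "('o, 'm, 'o, 'm) func" where
  "id_func = \<lparr>ob = (\<lambda>a. a), ar = (\<lambda>a b f. f)\<rparr>"

definition comp_func ::
    "('p, 'n, 'q, 'k) func \<Rightarrow> ('o, 'm, 'p, 'n) func \<Rightarrow> ('o, 'm, 'q, 'k) func"
    (infixr \<open>\<odot>\<close> 75) where
  "G \<odot> F = \<lparr>ob = (\<lambda>a. ob G (ob F a)), ar = (\<lambda>a b f. ar G (ob F a) (ob F b) (ar F a b f))\<rparr>"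

definition nat_trans ::
    "('o, 'm) cat \<Rightarrow> ('p, 'n) cat \<Rightarrow> ('o, 'm, 'p, 'n) func \<Rightarrow> ('o, 'm, 'p, 'n) func \<Rightarrow>
     ('o \<Rightarrow> 'n) set" where
  "nat_trans C D F G =
     {\<tau> \<in> (\<Pi>\<^sub>E a\<in>Obj C. Hom D (ob F a) (ob G a)).
        \<forall>a\<in>Obj C. \<forall>b\<in>Obj C. \<forall>f\<in>Hom C a b.
          Comp D (ob F a) (ob F b) (ob G b) (\<tau> b) (ar F a b f) =
          Comp D (ob F a) (ob G a) (ob G b) (ar G a b f) (\<tau> a)}"

definition func_cat :: "('o, 'm) cat \<Rightarrow> ('p, 'n) cat \<Rightarrow> (('o, 'm, 'p, 'n) func, 'o \<Rightarrow> 'n) cat" where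
  "func_cat C D =
     \<lparr>Obj = {F. is_functor C D F},
      Hom = nat_trans C D,
      Ident = (\<lambda>F. \<lambda>a\<in>Obj C. Ident D (ob F a)),
      Comp = (\<lambda>F G H \<tau> \<sigma>. \<lambda>a\<in>Obj C. Comp D (ob F a) (ob G a) (ob H a) (\<tau> a) (\<sigma> a))\<rparr>"

text \<open>For \<open>K : C \<rightarrow> D\<close>, \<open>whisker_right C \<tau> K\<close> is \<open>\<tau>K\<close>; for \<open>\<tau> : F \<rightarrow> G : C \<rightarrow> D\<close>,
  \<open>whisker_left C K F G \<tau>\<close> is \<open>K\<tau>\<close>.\<close>

definition whisker_right :: "('o, 'm) cat \<Rightarrow> ('p \<Rightarrow> 'k) \<Rightarrow> ('o, 'm, 'p, 'n) func \<Rightarrow> ('o \<Rightarrow> 'k)" where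
  "whisker_right C \<tau> K = (\<lambda>a\<in>Obj C. \<tau> (ob K a))"

definition whisker_left ::
    "('o, 'm) cat \<Rightarrow> ('p, 'n, 'q, 'k) func \<Rightarrow> ('o, 'm, 'p, 'n) func \<Rightarrow> ('o, 'm, 'p, 'n) func \<Rightarrow>
     ('o \<Rightarrow> 'n) \<Rightarrow> ('o \<Rightarrow> 'k)" where
  "whisker_left C K F G \<tau> = (\<lambda>a\<in>Obj C. ar K (ob F a) (ob G a) (\<tau> a))"


section \<open>Limits\<close>

definition cones ::
    "('j, 'l) cat \<Rightarrow> ('o, 'm) cat \<Rightarrow> ('j, 'l, 'o, 'm) func \<Rightarrow> 'o \<Rightarrow> ('j \<Rightarrow> 'm) set" where
  "cones J C E X =
     {\<pi> \<in> (\<Pi>\<^sub>E j\<in>Obj J. Hom C X (ob E j)).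
        \<forall>i\<in>Obj J. \<forall>j\<in>Obj J. \<forall>f\<in>Hom J i j.
          Comp C X (ob E i) (ob E j) (ar E i j f) (\<pi> i) = \<pi> j}"

definition is_limit ::
    "('j, 'l) cat \<Rightarrow> ('o, 'm) cat \<Rightarrow> ('j, 'l, 'o, 'm) func \<Rightarrow> 'o \<Rightarrow> ('j \<Rightarrow> 'm) \<Rightarrow> bool" where
  "is_limit J C E X \<pi> \<longleftrightarrow> is_functor J C E \<and> X \<in> Obj C \<and> \<pi> \<in> cones J C E X \<and>
     (\<forall>Y\<in>Obj C. \<forall>\<rho>\<in>cones J C E Y.
        \<exists>!u. u \<in> Hom C Y X \<and> (\<forall>j\<in>Obj J. Comp C Y X (ob E j) (\<pi> j) u = \<rho> j))"

definition D_complete :: "('i, 'l) cat set \<Rightarrow> ('o, 'm) cat \<Rightarrow> bool" where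
  "D_complete \<DD> C \<longleftrightarrow>
     (\<forall>I\<in>\<DD>. \<forall>E. is_functor (op_cat I) C E \<longrightarrow> (\<exists>X \<pi>. is_limit (op_cat I) C E X \<pi>))"


section \<open>Adjunctions, monads, Kan extensions\<close>

definition adjunction ::
    "('o, 'm) cat \<Rightarrow> ('p, 'n) cat \<Rightarrow> ('o, 'm, 'p, 'n) func \<Rightarrow> ('p, 'n, 'o, 'm) func \<Rightarrow>
     ('o \<Rightarrow> 'm) \<Rightarrow> ('p \<Rightarrow> 'n) \<Rightarrow> bool" where
  "adjunction C D F U \<eta> \<epsilon> \<longleftrightarrow> is_functor C D F \<and> is_functor D C U \<and>
     \<eta> \<in> nat_trans C C id_func (U \<odot> F) \<and>
     \<epsilon> \<in> nat_trans D D (F \<odot> U) id_func \<and>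
     (\<forall>c\<in>Obj C. Comp D (ob F c) (ob (F \<odot> U \<odot> F) c) (ob F c)
        (\<epsilon> (ob F c)) (ar F c (ob (U \<odot> F) c) (\<eta> c)) = Ident D (ob F c)) \<and>
     (\<forall>d\<in>Obj D. Comp C (ob U d) (ob (U \<odot> F \<odot> U) d) (ob U d)
        (ar U (ob (F \<odot> U) d) d (\<epsilon> d)) (\<eta> (ob U d)) = Ident C (ob U d))"

text \<open>\<open>U : D \<rightarrow> C\<close> is a right adjoint of \<open>F : C \<rightarrow> D\<close>, respectively of some functor.\<close>

definition is_right_adjoint_of ::
    "('o, 'm) cat \<Rightarrow> ('p, 'n) cat \<Rightarrow> ('o, 'm, 'p, 'n) func \<Rightarrow> ('p, 'n, 'o, 'm) func \<Rightarrow> bool" where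
  "is_right_adjoint_of C D F U \<longleftrightarrow> (\<exists>\<eta> \<epsilon>. adjunction C D F U \<eta> \<epsilon>)"

definition is_right_adjoint ::
    "('o, 'm) cat \<Rightarrow> ('p, 'n) cat \<Rightarrow> ('p, 'n, 'o, 'm) func \<Rightarrow> bool" where
  "is_right_adjoint C D U \<longleftrightarrow> (\<exists>F. is_right_adjoint_of C D F U)"

definition is_monad ::
    "('o, 'm) cat \<Rightarrow> ('o, 'm, 'o, 'm) func \<Rightarrow> ('o \<Rightarrow> 'm) \<Rightarrow> ('o \<Rightarrow> 'm) \<Rightarrow> bool" where
  "is_monad C T \<eta> \<mu> \<longleftrightarrow> is_functor C C T \<and>
     \<eta> \<in> nat_trans C C id_func T \<and> \<mu> \<in> nat_trans C C (T \<odot> T) T \<and>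
     (\<forall>c\<in>Obj C.
        Comp C (ob T c) (ob (T \<odot> T) c) (ob T c) (\<mu> c) (\<eta> (ob T c)) = Ident C (ob T c) \<and>
        Comp C (ob T c) (ob (T \<odot> T) c) (ob T c) (\<mu> c) (ar T c (ob T c) (\<eta> c)) =
          Ident C (ob T c) \<and>
        Comp C (ob (T \<odot> T \<odot> T) c) (ob (T \<odot> T) c) (ob T c) (\<mu> c) (\<mu> (ob T c)) =
        Comp C (ob (T \<odot> T \<odot> T) c) (ob (T \<odot> T) c) (ob T c) (\<mu> c)
          (ar T (ob (T \<odot> T) c) (ob T c) (\<mu> c)))"

text \<open>The multiplication \<open>U\<epsilon>F\<close> of the monad \<open>(UF, \<eta>, U\<epsilon>F)\<close> induced by an adjunction.\<close>

definition induced_mult ::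
    "('o, 'm) cat \<Rightarrow> ('o, 'm, 'p, 'n) func \<Rightarrow> ('p, 'n, 'o, 'm) func \<Rightarrow> ('p \<Rightarrow> 'n) \<Rightarrow> ('o \<Rightarrow> 'm)" where
  "induced_mult C F U \<epsilon> = (\<lambda>c\<in>Obj C. ar U (ob (F \<odot> U \<odot> F) c) (ob F c) (\<epsilon> (ob F c)))"

text \<open>\<open>L : B \<rightarrow> E\<close> with \<open>\<gamma> : X \<rightarrow> LK\<close> is the left Kan extension of \<open>X : A \<rightarrow> E\<close> along \<open>K : A \<rightarrow> B\<close>.\<close>

definition is_left_kan ::
    "('a, 'm) cat \<Rightarrow> ('b, 'n) cat \<Rightarrow> ('e, 'k) cat \<Rightarrow> ('a, 'm, 'b, 'n) func \<Rightarrow>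
     ('a, 'm, 'e, 'k) func \<Rightarrow> ('b, 'n, 'e, 'k) func \<Rightarrow> ('a \<Rightarrow> 'k) \<Rightarrow> bool" where
  "is_left_kan A B E K X L \<gamma> \<longleftrightarrow>
     is_functor A B K \<and> is_functor A E X \<and> is_functor B E L \<and>
     \<gamma> \<in> nat_trans A E X (L \<odot> K) \<and>
     (\<forall>S. is_functor B E S \<longrightarrow> (\<forall>\<sigma>\<in>nat_trans A E X (S \<odot> K).
        \<exists>!\<tau>. \<tau> \<in> nat_trans B E L S \<and>
          Comp (func_cat A E) X (L \<odot> K) (S \<odot> K) (whisker_right A \<tau> K) \<gamma> = \<sigma>))"

text \<open>\<open>R : B \<rightarrow> E\<close> with \<open>\<epsilon> : RK \<rightarrow> X\<close> is the right Kan extension of \<open>X : A \<rightarrow> E\<close> along \<open>K : A \<rightarrow> B\<close>.\<close>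

definition is_right_kan ::
    "('a, 'm) cat \<Rightarrow> ('b, 'n) cat \<Rightarrow> ('e, 'k) cat \<Rightarrow> ('a, 'm, 'b, 'n) func \<Rightarrow>
     ('a, 'm, 'e, 'k) func \<Rightarrow> ('b, 'n, 'e, 'k) func \<Rightarrow> ('a \<Rightarrow> 'k) \<Rightarrow> bool" where
  "is_right_kan A B E K X R \<epsilon> \<longleftrightarrow>
     is_functor A B K \<and> is_functor A E X \<and> is_functor B E R \<and>
     \<epsilon> \<in> nat_trans A E (R \<odot> K) X \<and>
     (\<forall>S. is_functor B E S \<longrightarrow> (\<forall>\<sigma>\<in>nat_trans A E (S \<odot> K) X.
        \<exists>!\<tau>. \<tau> \<in> nat_trans B E S R \<and>
          Comp (func_cat A E) (S \<odot> K) (R \<odot> K) X \<epsilon> (whisker_right A \<tau> K) = \<sigma>))"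

definition is_codensity_monad ::
    "('a, 'm) cat \<Rightarrow> ('b, 'n) cat \<Rightarrow> ('a, 'm, 'b, 'n) func \<Rightarrow>
     ('b, 'n, 'b, 'n) func \<Rightarrow> ('b \<Rightarrow> 'n) \<Rightarrow> ('b \<Rightarrow> 'n) \<Rightarrow> bool" where
  "is_codensity_monad A B G R \<eta> \<mu> \<longleftrightarrow> is_monad B R \<eta> \<mu> \<and>
     (\<exists>\<epsilon>. is_right_kan A B B G G R \<epsilon> \<and>
        Comp (func_cat A B) G (R \<odot> G) G \<epsilon> (whisker_right A \<eta> G) = Ident (func_cat A B) G \<and>
        Comp (func_cat A B) (R \<odot> R \<odot> G) (R \<odot> G) G \<epsilon> (whisker_right A \<mu> G) =
        Comp (func_cat A B) (R \<odot> R \<odot> G) (R \<odot> G) G \<epsilon> (whisker_left A R (R \<odot> G) G \<epsilon>))"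


section \<open>Formal limits\<close>

definition set_cat :: "('u set, 'u \<Rightarrow> 'u) cat" where
  "set_cat =
     \<lparr>Obj = {X. small TYPE('u) X},
      Hom = (\<lambda>X Y. X \<rightarrow>\<^sub>E Y),
      Ident = (\<lambda>X. \<lambda>x\<in>X. x),
      Comp = (\<lambda>X Y Z g f. compose X g f)\<rparr>"

definition hom_func :: "('a, 'u) cat \<Rightarrow> 'a \<Rightarrow> ('a, 'u, 'u set, 'u \<Rightarrow> 'u) func" where
  "hom_func A a = \<lparr>ob = Hom A a, ar = (\<lambda>b c g. \<lambda>f\<in>Hom A a b. Comp A a b c g f)\<rparr>"

text \<open>The Yoneda embedding, as a functor from \<open>A\<close> to the opposite of \<open>[A, Set]\<close> and to each of the
  full subcategories of this opposite that contain the representables.\<close>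

definition yoneda ::
    "('a, 'u) cat \<Rightarrow> ('a, 'u, ('a, 'u, 'u set, 'u \<Rightarrow> 'u) func, 'a \<Rightarrow> 'u \<Rightarrow> 'u) func" where
  "yoneda A = \<lparr>ob = hom_func A,
     ar = (\<lambda>a b f. \<lambda>c\<in>Obj A. \<lambda>g\<in>Hom A b c. Comp A a b c g f)\<rparr>"

text \<open>A small colimit of representables in \<open>[A, Set]\<close> is a small limit of representables in the
  opposite category; diagrams of representables are diagrams in \<open>A\<close>, by the Yoneda lemma.\<close>

definition small_functor :: "('a, 'u) cat \<Rightarrow> ('a, 'u, 'u set, 'u \<Rightarrow> 'u) func \<Rightarrow> bool" where
  "small_functor A P \<longleftrightarrow>
     (\<exists>(I :: ('u, 'u) cat) E \<pi>. small_cat I \<and> is_functor (op_cat I) A E \<and>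
        is_limit (op_cat I) (op_cat (func_cat A set_cat)) (yoneda A \<odot> E) P \<pi>)"

definition small_func_cat ::
    "('a, 'u) cat \<Rightarrow> (('a, 'u, 'u set, 'u \<Rightarrow> 'u) func, 'a \<Rightarrow> 'u \<Rightarrow> 'u) cat" where
  "small_func_cat A = full_subcat (func_cat A set_cat) (small_functor A)"

definition pro ::
    "('u, 'u) cat set \<Rightarrow> ('a, 'u) cat \<Rightarrow> (('a, 'u, 'u set, 'u \<Rightarrow> 'u) func, 'a \<Rightarrow> 'u \<Rightarrow> 'u) cat" where
  "pro \<DD> A = full_subcat (op_cat (small_func_cat A))
     (\<lambda>P. \<exists>I\<in>\<DD>. \<exists>E \<pi>. is_functor (op_cat I) A E \<and>
        is_limit (op_cat I) (op_cat (small_func_cat A)) (yoneda A \<odot> E) P \<pi>)"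

text \<open>
  \<open>H\<close> is \<open>Pro(\<DD>, G)\<close>: the functor that sends \<open>P\<close> to its left Kan extension along \<open>G\<close>, with units
  \<open>\<gamma> P : P \<rightarrow> (H P) G\<close>, and acts on arrows in the way that makes these units natural in \<open>P\<close>. As left
  Kan extensions are determined only up to isomorphism, so is \<open>H\<close>. An arrow \<open>\<tau> : P \<rightarrow> Q\<close> of
  \<open>Pro(\<DD>, A)\<close> is a natural transformation from \<open>Q\<close> to \<open>P\<close>.
\<close>

definition is_pro_func ::
    "('u, 'u) cat set \<Rightarrow> ('a, 'u) cat \<Rightarrow> ('b, 'u) cat \<Rightarrow> ('a, 'u, 'b, 'u) func \<Rightarrow>
     (('a, 'u, 'u set, 'u \<Rightarrow> 'u) func, 'a \<Rightarrow> 'u \<Rightarrow> 'u,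
      ('b, 'u, 'u set, 'u \<Rightarrow> 'u) func, 'b \<Rightarrow> 'u \<Rightarrow> 'u) func \<Rightarrow> bool" where
  "is_pro_func \<DD> A B G H \<longleftrightarrow> is_functor (pro \<DD> A) (pro \<DD> B) H \<and>
     (\<exists>\<gamma>. (\<forall>P\<in>Obj (pro \<DD> A). is_left_kan A B set_cat G P (ob H P) (\<gamma> P)) \<and>
       (\<forall>P\<in>Obj (pro \<DD> A). \<forall>Q\<in>Obj (pro \<DD> A). \<forall>\<tau>\<in>Hom (pro \<DD> A) P Q.
          Comp (func_cat A set_cat) Q P (ob H P \<odot> G) (\<gamma> P) \<tau> =
          Comp (func_cat A set_cat) Q (ob H Q \<odot> G) (ob H P \<odot> G)
            (whisker_right A (ar H P Q \<tau>) G) (\<gamma> Q)))"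

definition right_pro_adjoint ::
    "('u, 'u) cat set \<Rightarrow> ('a, 'u) cat \<Rightarrow> ('b, 'u) cat \<Rightarrow> ('a, 'u, 'b, 'u) func \<Rightarrow> bool" where
  "right_pro_adjoint \<DD> A B G \<longleftrightarrow>
     (\<exists>H. is_pro_func \<DD> A B G H \<and> is_right_adjoint (pro \<DD> B) (pro \<DD> A) H)"

end

theory Submission
  imports Defs
begin

text \<open>
  Write \<open>U\<close> for the composite \<open>Pro(\<DD>, A) \<rightarrow> Pro(\<DD>, B) \<rightarrow> B\<close>, \<open>F\<close> for its left adjoint and \<open>y\<close> for the
  Yoneda embedding of \<open>A\<close>. The left Kan extension of \<open>A(a, -)\<close> along \<open>G\<close> is \<open>B(G a, -)\<close>, whose actual
  limit is \<open>G a\<close>, so \<open>U y \<cong> G\<close>. By the Yoneda lemma \<open>(F b) a \<cong> Pro(\<DD>, A)(F b, y a) \<cong> B(b, U y a) \<cong>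
  B(b, G a)\<close>, hence \<open>B(b, U F c) \<cong> Pro(\<DD>, A)(F b, F c) \<cong> Nat(B(c, G-), B(b, G-))\<close>. This is the formula
  for the pointwise right Kan extension of \<open>G\<close> along itself. All that is used about \<open>Pro(\<DD>, A)\<close> in
  the second step is that \<open>y\<close> is codense: an arrow \<open>P \<rightarrow> Q\<close> is the same as a natural family of
  functions \<open>Hom(Q, y a) \<rightarrow> Hom(P, y a)\<close>.
\<close>

section \<open>Categories and universal arrows\<close>

text \<open>Left Kan extensions, actual limits and even the codes of functors admit choices. So
  \<open>H\<close>, \<open>L\<close> and \<open>F\<close> are arbitrary, \<open>U y\<close> agrees
  with \<open>G\<close> only up to an isomorphism \<open>\<theta>\<close>, and adjointness of Pro(D,
  G) is given for one choice of this functor and has to be moved to the others. This is why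
  universal arrows come first: units of adjunctions and of left Kan extensions are both of this
  kind, they determine objects up to isomorphism, they compose, and they can be transported along
  natural isomorphisms.

  As \<open>A\<close> may be large, the ends and weighted limits over \<open>A\<close> behind the
  formula for \<open>U F\<close> are never formed. Each is replaced by the unique existence of an
  arrow that induces a given natural family.

  That the monad structures agree, and not only the functors, is due to the choice of the Kan counit
  at \<open>a\<close>: it is \<open>\<theta> a\<close> after the image under \<open>U\<close> of the
  arrow \<open>F (G a) -> y a\<close> that corresponds to the identity of
  \<open>G a\<close>.\<close>

lemma category_ident [simp]: "category C \<Longrightarrow> a \<in> Obj C \<Longrightarrow> Ident C a \<in> Hom C a a"
  unfolding category_def by blast

lemma category_comp [simp]:
  "category C \<Longrightarrow> a \<in> Obj C \<Longrightarrow> b \<in> Obj C \<Longrightarrow> c \<in> Obj C \<Longrightarrow> f \<in> Hom C a b \<Longrightarrow>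
   g \<in> Hom C b c \<Longrightarrow> Comp C a b c g f \<in> Hom C a c"
  unfolding category_def by blast

lemma category_ident_right [simp]:
  "category C \<Longrightarrow> a \<in> Obj C \<Longrightarrow> b \<in> Obj C \<Longrightarrow> f \<in> Hom C a b \<Longrightarrow> Comp C a a b f (Ident C a) = f"
  unfolding category_def by blast

lemma category_ident_left [simp]:
  "category C \<Longrightarrow> a \<in> Obj C \<Longrightarrow> b \<in> Obj C \<Longrightarrow> f \<in> Hom C a b \<Longrightarrow> Comp C a b b (Ident C b) f = f"
  unfolding category_def by blast

lemma category_assoc:
  "category C \<Longrightarrow> a \<in> Obj C \<Longrightarrow> b \<in> Obj C \<Longrightarrow> c \<in> Obj C \<Longrightarrow> d \<in> Obj C \<Longrightarrow>
   f \<in> Hom C a b \<Longrightarrow> g \<in> Hom C b c \<Longrightarrow> h \<in> Hom C c d \<Longrightarrow>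
   Comp C a b d (Comp C b c d h g) f = Comp C a c d h (Comp C a b c g f)"
  unfolding category_def by blast

lemma op_cat_simps [simp]:
  "Obj (op_cat C) = Obj C" "Hom (op_cat C) a b = Hom C b a" "Ident (op_cat C) = Ident C"
  "Comp (op_cat C) a b c g f = Comp C c b a f g"
  by (simp_all add: op_cat_def)

lemma op_op_cat [simp]: "op_cat (op_cat C) = C"
  by (simp add: op_cat_def)

lemma category_op [simp]: "category C \<Longrightarrow> category (op_cat C)"
  unfolding category_def[of "op_cat C"] by (simp add: category_assoc)

lemma full_subcat_simps [simp]:
  "Obj (full_subcat C P) = {x \<in> Obj C. P x}" "Hom (full_subcat C P) = Hom C"
  "Ident (full_subcat C P) = Ident C" "Comp (full_subcat C P) = Comp C"
  by (simp_all add: full_subcat_def)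

lemma category_full_subcat [simp]: "category C \<Longrightarrow> category (full_subcat C P)"
  unfolding category_def[of "full_subcat C P"] by (simp add: category_assoc)

lemma functor_category:
  assumes "is_functor C D F"
  shows "category C" "category D"
  using assms by (simp_all add: is_functor_def)

lemma functor_simps:
  assumes "is_functor C D F"
  shows "a \<in> Obj C \<Longrightarrow> ob F a \<in> Obj D"
    "a \<in> Obj C \<Longrightarrow> b \<in> Obj C \<Longrightarrow> f \<in> Hom C a b \<Longrightarrow> ar F a b f \<in> Hom D (ob F a) (ob F b)"
    "a \<in> Obj C \<Longrightarrow> ar F a a (Ident C a) = Ident D (ob F a)"
    "a \<in> Obj C \<Longrightarrow> b \<in> Obj C \<Longrightarrow> c \<in> Obj C \<Longrightarrow> f \<in> Hom C a b \<Longrightarrow> g \<in> Hom C b c \<Longrightarrow>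
     ar F a c (Comp C a b c g f) =
       Comp D (ob F a) (ob F b) (ob F c) (ar F b c g) (ar F a b f)"
  using assms unfolding is_functor_def by blast+

lemma func_simps [simp]:
  "ob (G \<odot> F) a = ob G (ob F a)"
  "ar (G \<odot> F) a b f = ar G (ob F a) (ob F b) (ar F a b f)"
  "ob id_func a = a" "ar id_func a b f = f"
  by (simp_all add: comp_func_def id_func_def)

lemma comp_func_assoc: "(H \<odot> G) \<odot> F = H \<odot> G \<odot> F"
  by (simp add: comp_func_def)

lemma functor_comp:
  assumes "is_functor C D F" "is_functor D E G"
  shows "is_functor C E (G \<odot> F)"
  using functor_category[OF assms(1)] functor_category[OF assms(2)]
  by (auto simp: is_functor_def functor_simps[OF assms(1)] functor_simps[OF assms(2)])

lemma functor_full_subcat: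
  assumes "is_functor J (full_subcat C P) F" "category C"
  shows "is_functor J C F"
  using assms by (simp add: is_functor_def)

lemma functor_into_full_subcat:
  assumes "is_functor J C F" "\<And>j. j \<in> Obj J \<Longrightarrow> P (ob F j)"
  shows "is_functor J (full_subcat C P) F"
  using assms by (simp add: is_functor_def)

lemma functor_id: "category C \<Longrightarrow> is_functor C C id_func"
  by (simp add: is_functor_def)

lemma nat_trans_in: "\<tau> \<in> nat_trans C D F G \<Longrightarrow> a \<in> Obj C \<Longrightarrow> \<tau> a \<in> Hom D (ob F a) (ob G a)"
  by (auto simp: nat_trans_def)

lemma nat_trans_naturality:
  "\<tau> \<in> nat_trans C D F G \<Longrightarrow> a \<in> Obj C \<Longrightarrow> b \<in> Obj C \<Longrightarrow> f \<in> Hom C a b \<Longrightarrow>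
   Comp D (ob F a) (ob F b) (ob G b) (\<tau> b) (ar F a b f) =
   Comp D (ob F a) (ob G a) (ob G b) (ar G a b f) (\<tau> a)"
  by (auto simp: nat_trans_def)

lemma nat_trans_ext:
  "\<tau> \<in> nat_trans C D F G \<Longrightarrow> \<sigma> \<in> nat_trans C D F G \<Longrightarrow> (\<And>a. a \<in> Obj C \<Longrightarrow> \<tau> a = \<sigma> a) \<Longrightarrow> \<tau> = \<sigma>"
  by (auto simp: nat_trans_def intro: PiE_ext)

lemma nat_transI:
  assumes "\<tau> \<in> extensional (Obj C)"
    "\<And>a. a \<in> Obj C \<Longrightarrow> \<tau> a \<in> Hom D (ob F a) (ob G a)"
    "\<And>a b f. a \<in> Obj C \<Longrightarrow> b \<in> Obj C \<Longrightarrow> f \<in> Hom C a b \<Longrightarrow>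
       Comp D (ob F a) (ob F b) (ob G b) (\<tau> b) (ar F a b f) =
       Comp D (ob F a) (ob G a) (ob G b) (ar G a b f) (\<tau> a)"
  shows "\<tau> \<in> nat_trans C D F G"
  using assms by (auto simp: nat_trans_def PiE_def)

lemma nat_trans_full_subcat [simp]: "nat_trans C (full_subcat D P) = nat_trans C D"
  by (intro ext) (simp add: nat_trans_def)

text \<open>An initial object of the comma category of \<open>c\<close> over \<open>U\<close>. Units
  of adjunctions and of left Kan extensions are instances (\<open>adjunction_universal\<close>,
  \<open>left_kan_universal_arrow\<close>), so the same lemmas compare both.\<close>

definition universal_arrow ::
    "('p, 'n) cat \<Rightarrow> ('o, 'm) cat \<Rightarrow> ('p, 'n, 'o, 'm) func \<Rightarrow> 'o \<Rightarrow> 'p \<Rightarrow> 'm \<Rightarrow> bool" where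
  "universal_arrow D C U c d u \<longleftrightarrow> d \<in> Obj D \<and> u \<in> Hom C c (ob U d) \<and>
     (\<forall>d'\<in>Obj D. \<forall>f\<in>Hom C c (ob U d').
        \<exists>!g. g \<in> Hom D d d' \<and> Comp C c (ob U d) (ob U d') (ar U d d' g) u = f)"

lemma universal_arrowD:
  assumes "universal_arrow D C U c d u"
  shows "d \<in> Obj D" "u \<in> Hom C c (ob U d)"
  using assms by (simp_all add: universal_arrow_def)

lemma universal_arrow_ex:
  assumes "universal_arrow D C U c d u" "d' \<in> Obj D" "f \<in> Hom C c (ob U d')"
  obtains g where "g \<in> Hom D d d'" "Comp C c (ob U d) (ob U d') (ar U d d' g) u = f"
  using assms unfolding universal_arrow_def by blast

lemma universal_arrow_eq:
  assumes "universal_arrow D C U c d u" "d' \<in> Obj D" "g \<in> Hom D d d'" "h \<in> Hom D d d'"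
    "Comp C c (ob U d) (ob U d') (ar U d d' g) u = Comp C c (ob U d) (ob U d') (ar U d d' h) u"
    "is_functor D C U" "c \<in> Obj C"
  shows "g = h"
proof -
  note U = functor_simps[OF assms(6)] and cat = functor_category[OF assms(6)]
  have "d \<in> Obj D" "u \<in> Hom C c (ob U d)"
    using universal_arrowD[OF assms(1)] by auto
  then have "Comp C c (ob U d) (ob U d') (ar U d d' h) u \<in> Hom C c (ob U d')"
    using assms(2,4,7) cat by (simp add: U)
  then show ?thesis
    using assms(1-5) unfolding universal_arrow_def by blast
qed

section \<open>Adjunctions and their units as universal arrows\<close>

lemma adjunctionD:
  assumes "adjunction C D F U \<eta> \<epsilon>"
  shows "is_functor C D F" "is_functor D C U" "\<eta> \<in> nat_trans C C id_func (U \<odot> F)"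
    "\<epsilon> \<in> nat_trans D D (F \<odot> U) id_func"
    "c \<in> Obj C \<Longrightarrow> Comp D (ob F c) (ob F (ob U (ob F c))) (ob F c)
        (\<epsilon> (ob F c)) (ar F c (ob U (ob F c)) (\<eta> c)) = Ident D (ob F c)"
    "d \<in> Obj D \<Longrightarrow> Comp C (ob U d) (ob U (ob F (ob U d))) (ob U d)
        (ar U (ob F (ob U d)) d (\<epsilon> d)) (\<eta> (ob U d)) = Ident C (ob U d)"
  using assms by (simp_all add: adjunction_def)

lemma adjunction_transpose:
  assumes adj: "adjunction C D F U \<eta> \<epsilon>" and c: "c \<in> Obj C" and d: "d \<in> Obj D"
    and f: "f \<in> Hom C c (ob U d)"
  defines "g \<equiv> Comp D (ob F c) (ob F (ob U d)) d (\<epsilon> d) (ar F c (ob U d) f)"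
  shows "g \<in> Hom D (ob F c) d"
    and "Comp C c (ob U (ob F c)) (ob U d) (ar U (ob F c) d g) (\<eta> c) = f"
proof -
  note F = functor_simps[OF adjunctionD(1)[OF adj]] and U = functor_simps[OF adjunctionD(2)[OF adj]]
    and cat = functor_category[OF adjunctionD(1)[OF adj]]
  note \<eta> = nat_trans_in[OF adjunctionD(3)[OF adj], simplified]
    and \<epsilon> = nat_trans_in[OF adjunctionD(4)[OF adj], simplified]
  show "g \<in> Hom D (ob F c) d"
    unfolding g_def using c d f cat by (simp add: F U \<epsilon>)
  have "Comp C c (ob U (ob F c)) (ob U d) (ar U (ob F c) d g) (\<eta> c) =
      Comp C c (ob U (ob F (ob U d))) (ob U d) (ar U (ob F (ob U d)) d (\<epsilon> d))
        (Comp C c (ob U (ob F c)) (ob U (ob F (ob U d)))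
          (ar U (ob F c) (ob F (ob U d)) (ar F c (ob U d) f)) (\<eta> c))"
    unfolding g_def using c d f cat by (simp add: F U \<eta> \<epsilon> category_assoc)
  also have "\<dots> = Comp C c (ob U (ob F (ob U d))) (ob U d) (ar U (ob F (ob U d)) d (\<epsilon> d))
        (Comp C c (ob U d) (ob U (ob F (ob U d))) (\<eta> (ob U d)) f)"
    using nat_trans_naturality[OF adjunctionD(3)[OF adj] c _ f] d by (simp add: U)
  also have "\<dots> = Comp C c (ob U d) (ob U d) (Comp C (ob U d) (ob U (ob F (ob U d))) (ob U d)
        (ar U (ob F (ob U d)) d (\<epsilon> d)) (\<eta> (ob U d))) f"
    using c d f cat by (simp add: F U \<eta> \<epsilon> category_assoc)
  also have "\<dots> = f"
    using adjunctionD(6)[OF adj d] c d f cat by (simp add: U)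
  finally show "Comp C c (ob U (ob F c)) (ob U d) (ar U (ob F c) d g) (\<eta> c) = f" .
qed

lemma adjunction_transpose_inverse:
  assumes adj: "adjunction C D F U \<eta> \<epsilon>" and c: "c \<in> Obj C" and d: "d \<in> Obj D"
    and g: "g \<in> Hom D (ob F c) d"
  shows "Comp D (ob F c) (ob F (ob U d)) d (\<epsilon> d) (ar F c (ob U d)
    (Comp C c (ob U (ob F c)) (ob U d) (ar U (ob F c) d g) (\<eta> c))) = g"
    (is "?L = g")
proof -
  note F = functor_simps[OF adjunctionD(1)[OF adj]] and U = functor_simps[OF adjunctionD(2)[OF adj]]
    and cat = functor_category[OF adjunctionD(1)[OF adj]]
  note \<eta> = nat_trans_in[OF adjunctionD(3)[OF adj], simplified]
    and \<epsilon> = nat_trans_in[OF adjunctionD(4)[OF adj], simplified]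
  have "?L = Comp D (ob F c) (ob F (ob U (ob F c))) d
      (Comp D (ob F (ob U (ob F c))) (ob F (ob U d)) d (\<epsilon> d)
        (ar F (ob U (ob F c)) (ob U d) (ar U (ob F c) d g)))
      (ar F c (ob U (ob F c)) (\<eta> c))"
    using c d g cat by (simp add: F U \<eta> \<epsilon> category_assoc)
  also have "\<dots> = Comp D (ob F c) (ob F (ob U (ob F c))) d
      (Comp D (ob F (ob U (ob F c))) (ob F c) d g (\<epsilon> (ob F c)))
      (ar F c (ob U (ob F c)) (\<eta> c))"
    using nat_trans_naturality[OF adjunctionD(4)[OF adj] _ d g] c by (simp add: F)
  also have "\<dots> = g"
    using adjunctionD(5)[OF adj c] c d g cat by (simp add: F U \<eta> \<epsilon> category_assoc)
  finally show ?thesis .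
qed

lemma adjunction_universal:
  assumes adj: "adjunction C D F U \<eta> \<epsilon>" and c: "c \<in> Obj C"
  shows "universal_arrow D C U c (ob F c) (\<eta> c)"
  unfolding universal_arrow_def
proof (intro conjI ballI)
  show "ob F c \<in> Obj D"
    using functor_simps[OF adjunctionD(1)[OF adj]] c by simp
  show "\<eta> c \<in> Hom C c (ob U (ob F c))"
    using nat_trans_in[OF adjunctionD(3)[OF adj] c] by simp
  fix d f assume d: "d \<in> Obj D" and f: "f \<in> Hom C c (ob U d)"
  show "\<exists>!g. g \<in> Hom D (ob F c) d \<and> Comp C c (ob U (ob F c)) (ob U d) (ar U (ob F c) d g) (\<eta> c) = f"
    using adjunction_transpose[OF adj c d f] adjunction_transpose_inverse[OF adj c d] by metis
qed

text \<open>A chosen universal arrow at each \<open>c\<close> forces the action on arrows: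
  \<open>F f\<close> is the factorization of \<open>\<eta> b\<close> after \<open>f\<close>. Arrows
  out of \<open>F0 c\<close> agree as soon as their images under \<open>U\<close> agree after
  \<open>\<eta> c\<close>; functoriality, naturality of \<open>\<epsilon>\<close> and the first
  triangle identity are checked in this way, and the second triangle identity defines
  \<open>\<epsilon>\<close>.\<close>

lemma left_adjoint_exists:
  assumes U: "is_functor D C U" and univ: "\<And>c. c \<in> Obj C \<Longrightarrow> \<exists>d u. universal_arrow D C U c d u"
  shows "is_right_adjoint C D U"
proof -
  note Us = functor_simps[OF U] and cat = functor_category[OF U]
  obtain F0 \<eta>0 where univ0: "universal_arrow D C U c (F0 c) (\<eta>0 c)" if "c \<in> Obj C" for c
    using univ by metis
  define \<eta> where "\<eta> = (\<lambda>c\<in>Obj C. \<eta>0 c)"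
  have univ': "universal_arrow D C U c (F0 c) (\<eta> c)" if "c \<in> Obj C" for c
    using univ0[OF that] that by (simp add: \<eta>_def)
  note F0 = universal_arrowD(1)[OF univ'] and \<eta>0 = universal_arrowD(2)[OF univ']
  have "\<exists>g. g \<in> Hom D (F0 c) d \<and> Comp C c (ob U (F0 c)) (ob U d) (ar U (F0 c) d g) (\<eta> c) = f"
    if "c \<in> Obj C" "d \<in> Obj D" "f \<in> Hom C c (ob U d)" for c d f
    using universal_arrow_ex[OF univ'[OF that(1)] that(2,3)] by metis
  then obtain tr where tr: "tr c d f \<in> Hom D (F0 c) d"
      "Comp C c (ob U (F0 c)) (ob U d) (ar U (F0 c) d (tr c d f)) (\<eta> c) = f"
    if "c \<in> Obj C" "d \<in> Obj D" "f \<in> Hom C c (ob U d)" for c d f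
    by metis
  have eq: "g = h" if "c \<in> Obj C" "d \<in> Obj D" "g \<in> Hom D (F0 c) d" "h \<in> Hom D (F0 c) d"
      "Comp C c (ob U (F0 c)) (ob U d) (ar U (F0 c) d g) (\<eta> c) =
       Comp C c (ob U (F0 c)) (ob U d) (ar U (F0 c) d h) (\<eta> c)" for c d g h
    using universal_arrow_eq[OF univ'[OF that(1)] that(2-5) U that(1)] .
  define F where "F = \<lparr>ob = F0, ar = (\<lambda>a b f. tr a (F0 b) (Comp C a b (ob U (F0 b)) (\<eta> b) f))\<rparr>"
  define \<epsilon> where "\<epsilon> = (\<lambda>d\<in>Obj D. tr (ob U d) d (Ident C (ob U d)))"
  have Fo: "ob F c = F0 c" for c
    by (simp add: F_def)
  have Fa: "ar F a b f \<in> Hom D (F0 a) (F0 b)"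
      "Comp C a (ob U (F0 a)) (ob U (F0 b)) (ar U (F0 a) (F0 b) (ar F a b f)) (\<eta> a) =
       Comp C a b (ob U (F0 b)) (\<eta> b) f"
    if "a \<in> Obj C" "b \<in> Obj C" "f \<in> Hom C a b" for a b f
    using that cat by (simp_all add: F_def tr F0 \<eta>0 Us)
  have \<epsilon>: "\<epsilon> d \<in> Hom D (F0 (ob U d)) d"
      "Comp C (ob U d) (ob U (F0 (ob U d))) (ob U d) (ar U (F0 (ob U d)) d (\<epsilon> d)) (\<eta> (ob U d)) =
       Ident C (ob U d)"
    if "d \<in> Obj D" for d
    using that cat by (simp_all add: \<epsilon>_def tr Us)
  have F: "is_functor C D F"
    unfolding is_functor_def Fo
  proof (intro conjI ballI)
    fix a assume a: "a \<in> Obj C"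
    show "ar F a a (Ident C a) = Ident D (F0 a)"
      by (rule eq[OF a F0[OF a]]) (use a cat in \<open>simp_all add: Fa F0 \<eta>0 Us\<close>)
  next
    fix a b c f g
    assume *: "a \<in> Obj C" "b \<in> Obj C" "c \<in> Obj C" "f \<in> Hom C a b" "g \<in> Hom C b c"
    have "Comp C a (ob U (F0 a)) (ob U (F0 c))
        (ar U (F0 a) (F0 c) (Comp D (F0 a) (F0 b) (F0 c) (ar F b c g) (ar F a b f))) (\<eta> a) =
      Comp C a (ob U (F0 b)) (ob U (F0 c)) (ar U (F0 b) (F0 c) (ar F b c g))
        (Comp C a b (ob U (F0 b)) (\<eta> b) f)"
      using * cat by (simp add: Fa F0 \<eta>0 Us category_assoc)
    also have "\<dots> = Comp C a b (ob U (F0 c)) (Comp C b (ob U (F0 b)) (ob U (F0 c))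
        (ar U (F0 b) (F0 c) (ar F b c g)) (\<eta> b)) f"
      using * cat by (simp add: Fa(1) F0 \<eta>0 Us category_assoc)
    also have "\<dots> = Comp C a c (ob U (F0 c)) (\<eta> c) (Comp C a b c g f)"
      using * cat by (simp add: Fa F0 \<eta>0 Us category_assoc)
    finally show "ar F a c (Comp C a b c g f) =
        Comp D (F0 a) (F0 b) (F0 c) (ar F b c g) (ar F a b f)"
      by (intro eq[OF *(1) F0[OF *(3)]]) (use * cat in \<open>simp_all add: Fa F0 \<eta>0 Us\<close>)
  qed (simp_all add: cat Fa F0)
  have \<eta>nat: "\<eta> \<in> nat_trans C C id_func (U \<odot> F)"
    by (rule nat_transI) (simp_all add: \<eta>0 Fo Fa, simp add: \<eta>_def)
  have \<epsilon>nat: "\<epsilon> \<in> nat_trans D D (F \<odot> U) id_func"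
  proof (rule nat_transI)
    fix d e g assume *: "d \<in> Obj D" "e \<in> Obj D" "g \<in> Hom D d e"
    let ?Fg = "ar F (ob U d) (ob U e) (ar U d e g)"
    have "Comp C (ob U d) (ob U (F0 (ob U d))) (ob U e) (ar U (F0 (ob U d)) e
          (Comp D (F0 (ob U d)) (F0 (ob U e)) e (\<epsilon> e) ?Fg)) (\<eta> (ob U d)) =
        Comp C (ob U d) (ob U (F0 (ob U e))) (ob U e) (ar U (F0 (ob U e)) e (\<epsilon> e))
          (Comp C (ob U d) (ob U e) (ob U (F0 (ob U e))) (\<eta> (ob U e)) (ar U d e g))"
      using * cat by (simp add: \<epsilon> Fa F0 \<eta>0 Us category_assoc)
    also have "\<dots> = Comp C (ob U d) (ob U e) (ob U e) (Comp C (ob U e) (ob U (F0 (ob U e))) (ob U e)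
          (ar U (F0 (ob U e)) e (\<epsilon> e)) (\<eta> (ob U e))) (ar U d e g)"
      using * cat by (simp add: \<epsilon>(1) F0 \<eta>0 Us category_assoc)
    also have "\<dots> = Comp C (ob U d) (ob U (F0 (ob U d))) (ob U e) (ar U (F0 (ob U d)) e
          (Comp D (F0 (ob U d)) d e g (\<epsilon> d))) (\<eta> (ob U d))"
      using * cat by (simp add: \<epsilon> F0 \<eta>0 Us category_assoc)
    finally have "Comp D (F0 (ob U d)) (F0 (ob U e)) e (\<epsilon> e) ?Fg = Comp D (F0 (ob U d)) d e g (\<epsilon> d)"
      by (intro eq[where c = "ob U d", OF _ *(2)]) (use * cat in \<open>simp_all add: \<epsilon> Fa F0 Us\<close>)
    then show "Comp D (ob (F \<odot> U) d) (ob (F \<odot> U) e) (ob id_func e) (\<epsilon> e) (ar (F \<odot> U) d e g) =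
        Comp D (ob (F \<odot> U) d) (ob id_func d) (ob id_func e) (ar id_func d e g) (\<epsilon> d)"
      by (simp add: Fo)
  qed (simp_all add: \<epsilon> Fo, simp add: \<epsilon>_def)
  have tri: "Comp D (F0 c) (F0 (ob U (F0 c))) (F0 c) (\<epsilon> (F0 c)) (ar F c (ob U (F0 c)) (\<eta> c)) =
      Ident D (F0 c)" if c: "c \<in> Obj C" for c
  proof -
    let ?UF = "\<lambda>x. ob U (F0 x)"
    have "Comp C c (?UF c) (?UF c) (ar U (F0 c) (F0 c)
          (Comp D (F0 c) (F0 (?UF c)) (F0 c) (\<epsilon> (F0 c)) (ar F c (?UF c) (\<eta> c)))) (\<eta> c) =
        Comp C c (?UF (?UF c)) (?UF c) (ar U (F0 (?UF c)) (F0 c) (\<epsilon> (F0 c)))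
          (Comp C c (?UF c) (?UF (?UF c)) (\<eta> (?UF c)) (\<eta> c))"
      using c cat by (simp add: \<epsilon> Fa F0 \<eta>0 Us category_assoc)
    also have "\<dots> = Comp C c (?UF c) (?UF c) (Comp C (?UF c) (?UF (?UF c)) (?UF c)
        (ar U (F0 (?UF c)) (F0 c) (\<epsilon> (F0 c))) (\<eta> (?UF c))) (\<eta> c)"
      using c cat by (simp add: \<epsilon>(1) F0 \<eta>0 Us category_assoc)
    also have "\<dots> = Comp C c (?UF c) (?UF c) (ar U (F0 c) (F0 c) (Ident D (F0 c))) (\<eta> c)"
      using c cat by (simp add: \<epsilon> F0 \<eta>0 Us)
    finally show ?thesis
      by (intro eq[OF c F0[OF c]]) (use c cat in \<open>simp_all add: \<epsilon> Fa F0 \<eta>0 Us\<close>)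
  qed
  have "adjunction C D F U \<eta> \<epsilon>"
    using F U \<eta>nat \<epsilon>nat by (simp add: adjunction_def tri \<epsilon> Fo)
  then show ?thesis
    unfolding is_right_adjoint_def is_right_adjoint_of_def by blast
qed

text \<open>Factor through \<open>u\<close> first, then through \<open>v\<close>. This is how the
  left adjoint of \<open>L \<odot> H\<close> is found one object at a time.\<close>

lemma universal_arrow_comp:
  assumes U: "is_functor D C U" and V: "is_functor E D V" and c: "c \<in> Obj C"
    and u: "universal_arrow D C U c d u" and v: "universal_arrow E D V d e v"
  shows "universal_arrow E C (U \<odot> V) c e
    (Comp C c (ob U d) (ob U (ob V e)) (ar U d (ob V e) v) u)"
  unfolding universal_arrow_def
proof (intro conjI ballI)
  note Us = functor_simps[OF U] and Vs = functor_simps[OF V]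
    and cat = functor_category[OF U] functor_category[OF V]
    and ud = universal_arrowD[OF u] and vd = universal_arrowD[OF v]
  show "e \<in> Obj E"
    by (rule vd)
  show "Comp C c (ob U d) (ob U (ob V e)) (ar U d (ob V e) v) u \<in> Hom C c (ob (U \<odot> V) e)"
    using c ud vd cat by (simp add: Us Vs)
  fix x f assume x: "x \<in> Obj E" and f: "f \<in> Hom C c (ob (U \<odot> V) x)"
  have eq: "Comp C c (ob U (ob V e)) (ob U (ob V x)) (ar U (ob V e) (ob V x) (ar V e x g))
        (Comp C c (ob U d) (ob U (ob V e)) (ar U d (ob V e) v) u) =
      Comp C c (ob U d) (ob U (ob V x)) (ar U d (ob V x) (Comp D d (ob V e) (ob V x) (ar V e x g) v)) u"
    if "g \<in> Hom E e x" for g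
    using that c x ud vd cat by (simp add: Us Vs category_assoc)
  obtain h where h: "h \<in> Hom D d (ob V x)" "Comp C c (ob U d) (ob U (ob V x)) (ar U d (ob V x) h) u = f"
    using universal_arrow_ex[OF u _ f[simplified]] Vs(1)[OF x] by metis
  obtain g where g: "g \<in> Hom E e x" "Comp D d (ob V e) (ob V x) (ar V e x g) v = h"
    using universal_arrow_ex[OF v x h(1)] by metis
  show "\<exists>!g. g \<in> Hom E e x \<and> Comp C c (ob (U \<odot> V) e) (ob (U \<odot> V) x) (ar (U \<odot> V) e x g)
      (Comp C c (ob U d) (ob U (ob V e)) (ar U d (ob V e) v) u) = f"
  proof (rule ex1I[of _ g])
    fix k assume "k \<in> Hom E e x \<and> Comp C c (ob (U \<odot> V) e) (ob (U \<odot> V) x) (ar (U \<odot> V) e x k)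
      (Comp C c (ob U d) (ob U (ob V e)) (ar U d (ob V e) v) u) = f"
    then have k: "k \<in> Hom E e x" "Comp C c (ob U d) (ob U (ob V x))
        (ar U d (ob V x) (Comp D d (ob V e) (ob V x) (ar V e x k) v)) u = f"
      using eq[of k] by simp_all
    have "Comp D d (ob V e) (ob V x) (ar V e x k) v = h"
      by (rule universal_arrow_eq[OF u _ _ h(1) _ U c]) (use k h x ud vd cat in \<open>simp_all add: Vs\<close>)
    then show "k = g"
      using universal_arrow_eq[OF v x k(1) g(1) _ V ud(1)] g(2) by simp
  qed (use eq[OF g(1)] g h in simp)
qed

section \<open>Natural isomorphisms and their effect on universal arrows\<close>

definition nat_iso ::
    "('o, 'm) cat \<Rightarrow> ('p, 'n) cat \<Rightarrow> ('o, 'm, 'p, 'n) func \<Rightarrow> ('o, 'm, 'p, 'n) func \<Rightarrow>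
     ('o \<Rightarrow> 'n) \<Rightarrow> ('o \<Rightarrow> 'n) \<Rightarrow> bool" where
  "nat_iso C D F G \<tau> \<sigma> \<longleftrightarrow> \<tau> \<in> nat_trans C D F G \<and> \<sigma> \<in> nat_trans C D G F \<and>
     (\<forall>c\<in>Obj C. Comp D (ob F c) (ob G c) (ob F c) (\<sigma> c) (\<tau> c) = Ident D (ob F c) \<and>
        Comp D (ob G c) (ob F c) (ob G c) (\<tau> c) (\<sigma> c) = Ident D (ob G c))"

lemma nat_isoD:
  assumes "nat_iso C D F G \<tau> \<sigma>"
  shows "\<tau> \<in> nat_trans C D F G" "\<sigma> \<in> nat_trans C D G F"
    "c \<in> Obj C \<Longrightarrow> Comp D (ob F c) (ob G c) (ob F c) (\<sigma> c) (\<tau> c) = Ident D (ob F c)"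
    "c \<in> Obj C \<Longrightarrow> Comp D (ob G c) (ob F c) (ob G c) (\<tau> c) (\<sigma> c) = Ident D (ob G c)"
  using assms by (simp_all add: nat_iso_def)

lemma nat_iso_full_subcat [simp]: "nat_iso C (full_subcat D P) = nat_iso C D"
  by (intro ext) (simp add: nat_iso_def)

lemma nat_iso_sym: "nat_iso C D F G \<tau> \<sigma> \<Longrightarrow> nat_iso C D G F \<sigma> \<tau>"
  by (simp add: nat_iso_def)

text \<open>Objectwise inverses are natural by themselves: insert \<open>\<tau> a\<close> after
  \<open>\<sigma> a\<close>, move \<open>\<tau>\<close> past \<open>f\<close> by naturality, and
  cancel \<open>\<sigma> b\<close> against \<open>\<tau> b\<close>.\<close>

lemma nat_isoI:
  assumes F: "is_functor C D F" and G: "is_functor C D G" and \<tau>: "\<tau> \<in> nat_trans C D F G"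
    and ext: "\<sigma> \<in> extensional (Obj C)"
    and \<sigma>: "\<And>c. c \<in> Obj C \<Longrightarrow> \<sigma> c \<in> Hom D (ob G c) (ob F c)"
    and \<sigma>\<tau>: "\<And>c. c \<in> Obj C \<Longrightarrow> Comp D (ob F c) (ob G c) (ob F c) (\<sigma> c) (\<tau> c) = Ident D (ob F c)"
    and \<tau>\<sigma>: "\<And>c. c \<in> Obj C \<Longrightarrow> Comp D (ob G c) (ob F c) (ob G c) (\<tau> c) (\<sigma> c) = Ident D (ob G c)"
  shows "nat_iso C D F G \<tau> \<sigma>"
proof -
  note Fs = functor_simps[OF F] and Gs = functor_simps[OF G] and cat = functor_category[OF F]
    and \<tau>s = nat_trans_in[OF \<tau>]
  have "\<sigma> \<in> nat_trans C D G F"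
  proof (rule nat_transI[OF ext])
    fix a b f assume *: "a \<in> Obj C" "b \<in> Obj C" "f \<in> Hom C a b"
    have "Comp D (ob G a) (ob G b) (ob F b) (\<sigma> b) (ar G a b f) =
        Comp D (ob G a) (ob G b) (ob F b) (\<sigma> b)
          (Comp D (ob G a) (ob G a) (ob G b) (ar G a b f)
            (Comp D (ob G a) (ob F a) (ob G a) (\<tau> a) (\<sigma> a)))"
      using * cat by (simp add: Gs \<tau>\<sigma>)
    also have "\<dots> = Comp D (ob G a) (ob F a) (ob F b) (Comp D (ob F a) (ob G b) (ob F b) (\<sigma> b)
          (Comp D (ob F a) (ob G a) (ob G b) (ar G a b f) (\<tau> a))) (\<sigma> a)"
      using * cat by (simp add: Fs Gs \<tau>s \<sigma> category_assoc del: \<tau>\<sigma>)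
    also have "\<dots> = Comp D (ob G a) (ob F a) (ob F b) (Comp D (ob F a) (ob F b) (ob F b)
          (Comp D (ob F b) (ob G b) (ob F b) (\<sigma> b) (\<tau> b)) (ar F a b f)) (\<sigma> a)"
      using * cat nat_trans_naturality[OF \<tau> *]
      by (simp add: Fs Gs \<tau>s \<sigma> category_assoc[where f = "ar F a b f"] del: \<sigma>\<tau>)
    also have "\<dots> = Comp D (ob G a) (ob F a) (ob F b) (ar F a b f) (\<sigma> a)"
      using * cat by (simp add: Fs \<sigma>\<tau>)
    finally show "Comp D (ob G a) (ob G b) (ob F b) (\<sigma> b) (ar G a b f) =
        Comp D (ob G a) (ob F a) (ob F b) (ar F a b f) (\<sigma> a)" .
  qed (rule \<sigma>)
  then show ?thesis
    using \<tau> \<sigma>\<tau> \<tau>\<sigma> by (simp add: nat_iso_def)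
qed

lemma nat_iso_trans:
  assumes F: "is_functor C D F" and G: "is_functor C D G" and H: "is_functor C D H"
    and \<tau>: "nat_iso C D F G \<tau> \<tau>'" and \<sigma>: "nat_iso C D G H \<sigma> \<sigma>'"
  shows "\<exists>\<rho> \<rho>'. nat_iso C D F H \<rho> \<rho>'"
proof (intro exI nat_isoI)
  note Fs = functor_simps[OF F] and Gs = functor_simps[OF G] and Hs = functor_simps[OF H]
    and cat = functor_category[OF F]
    and \<tau>s = nat_trans_in[OF nat_isoD(1)[OF \<tau>]] nat_trans_in[OF nat_isoD(2)[OF \<tau>]]
      nat_trans_in[OF nat_isoD(1)[OF \<sigma>]] nat_trans_in[OF nat_isoD(2)[OF \<sigma>]]
    and \<tau>i = nat_isoD(3,4)[OF \<tau>] and \<sigma>i = nat_isoD(3,4)[OF \<sigma>]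
  let ?\<rho> = "\<lambda>c\<in>Obj C. Comp D (ob F c) (ob G c) (ob H c) (\<sigma> c) (\<tau> c)"
  let ?\<rho>' = "\<lambda>c\<in>Obj C. Comp D (ob H c) (ob G c) (ob F c) (\<tau>' c) (\<sigma>' c)"
  show "is_functor C D F" "is_functor C D H"
    by (fact F H)+
  show "?\<rho>' \<in> extensional (Obj C)"
    by simp
  show "?\<rho> \<in> nat_trans C D F H"
  proof (rule nat_transI)
    fix a b f assume *: "a \<in> Obj C" "b \<in> Obj C" "f \<in> Hom C a b"
    have "Comp D (ob F a) (ob F b) (ob H b) (?\<rho> b) (ar F a b f) =
        Comp D (ob F a) (ob G b) (ob H b) (\<sigma> b)
          (Comp D (ob F a) (ob F b) (ob G b) (\<tau> b) (ar F a b f))"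
      using * cat by (simp add: Fs Gs Hs \<tau>s category_assoc)
    also have "\<dots> = Comp D (ob F a) (ob G a) (ob H b)
          (Comp D (ob G a) (ob G b) (ob H b) (\<sigma> b) (ar G a b f)) (\<tau> a)"
      using * cat nat_trans_naturality[OF nat_isoD(1)[OF \<tau>] *]
      by (simp add: Fs Gs Hs \<tau>s category_assoc)
    also have "\<dots> = Comp D (ob F a) (ob H a) (ob H b) (ar H a b f) (?\<rho> a)"
      using * cat nat_trans_naturality[OF nat_isoD(1)[OF \<sigma>] *]
      by (simp add: Fs Gs Hs \<tau>s category_assoc)
    finally show "Comp D (ob F a) (ob F b) (ob H b) (?\<rho> b) (ar F a b f) =
        Comp D (ob F a) (ob H a) (ob H b) (ar H a b f) (?\<rho> a)" .
  qed (use cat in \<open>simp_all add: Fs Gs Hs \<tau>s\<close>)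
  fix c assume c: "c \<in> Obj C"
  show "?\<rho>' c \<in> Hom D (ob H c) (ob F c)"
    using c cat by (simp add: Fs Gs Hs \<tau>s)
  have "Comp D (ob F c) (ob H c) (ob F c) (?\<rho>' c) (?\<rho> c) =
      Comp D (ob F c) (ob G c) (ob F c) (\<tau>' c)
        (Comp D (ob F c) (ob G c) (ob G c) (Comp D (ob G c) (ob H c) (ob G c) (\<sigma>' c) (\<sigma> c)) (\<tau> c))"
    using c cat by (simp add: Fs Gs Hs \<tau>s category_assoc)
  then show "Comp D (ob F c) (ob H c) (ob F c) (?\<rho>' c) (?\<rho> c) = Ident D (ob F c)"
    using c cat by (simp add: Fs Gs Hs \<tau>s \<tau>i \<sigma>i)
  have "Comp D (ob H c) (ob F c) (ob H c) (?\<rho> c) (?\<rho>' c) =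
      Comp D (ob H c) (ob G c) (ob H c) (\<sigma> c)
        (Comp D (ob H c) (ob G c) (ob G c) (Comp D (ob G c) (ob F c) (ob G c) (\<tau> c) (\<tau>' c)) (\<sigma>' c))"
    using c cat by (simp add: Fs Gs Hs \<tau>s category_assoc)
  then show "Comp D (ob H c) (ob F c) (ob H c) (?\<rho> c) (?\<rho>' c) = Ident D (ob H c)"
    using c cat by (simp add: Fs Gs Hs \<tau>s \<tau>i \<sigma>i)
qed

lemma whisker_left_nat_trans:
  assumes "is_functor D E K" "is_functor C D F" "is_functor C D G" "\<tau> \<in> nat_trans C D F G"
  shows "whisker_left C K F G \<tau> \<in> nat_trans C E (K \<odot> F) (K \<odot> G)"
proof (rule nat_transI)
  note Ks = functor_simps[OF assms(1)] and Fs = functor_simps[OF assms(2)]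
    and Gs = functor_simps[OF assms(3)] and \<tau> = nat_trans_in[OF assms(4)]
  fix a b f assume *: "a \<in> Obj C" "b \<in> Obj C" "f \<in> Hom C a b"
  show "Comp E (ob (K \<odot> F) a) (ob (K \<odot> F) b) (ob (K \<odot> G) b)
      (whisker_left C K F G \<tau> b) (ar (K \<odot> F) a b f) =
    Comp E (ob (K \<odot> F) a) (ob (K \<odot> G) a) (ob (K \<odot> G) b)
      (ar (K \<odot> G) a b f) (whisker_left C K F G \<tau> a)"
    using arg_cong[where f = "ar K (ob F a) (ob G b)", OF nat_trans_naturality[OF assms(4) *]] *
    by (simp add: whisker_left_def Ks Fs Gs \<tau>)
qed (use functor_simps[OF assms(1)] functor_simps[OF assms(2)] functor_simps[OF assms(3)]
      nat_trans_in[OF assms(4)] in \<open>simp_all add: whisker_left_def\<close>)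

lemma nat_iso_whisker_left:
  assumes "is_functor D E K" "is_functor C D F" "is_functor C D G" "nat_iso C D F G \<tau> \<sigma>"
  shows "nat_iso C E (K \<odot> F) (K \<odot> G) (whisker_left C K F G \<tau>) (whisker_left C K G F \<sigma>)"
proof -
  note Ks = functor_simps[OF assms(1)] and Fs = functor_simps[OF assms(2)]
    and Gs = functor_simps[OF assms(3)] and iso = nat_isoD[OF assms(4)]
  note ins = nat_trans_in[OF iso(1)] nat_trans_in[OF iso(2)]
  show ?thesis
    unfolding nat_iso_def
    using whisker_left_nat_trans[OF assms(1-3) iso(1)] whisker_left_nat_trans[OF assms(1,3,2) iso(2)]
    by (simp add: whisker_left_def Ks(1,3) Fs Gs ins iso(3,4) flip: Ks(4))
qed

lemma whisker_right_nat_trans: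
  assumes "is_functor B C K" "\<tau> \<in> nat_trans C D F G"
  shows "whisker_right B \<tau> K \<in> nat_trans B D (F \<odot> K) (G \<odot> K)"
  using functor_simps[OF assms(1)] nat_trans_in[OF assms(2)] nat_trans_naturality[OF assms(2)]
  by (intro nat_transI) (simp_all add: whisker_right_def)

lemma nat_iso_whisker_right:
  assumes "is_functor B C K" "nat_iso C D F G \<tau> \<sigma>"
  shows "nat_iso B D (F \<odot> K) (G \<odot> K) (whisker_right B \<tau> K) (whisker_right B \<sigma> K)"
proof -
  note iso = nat_isoD[OF assms(2)]
  show ?thesis
    unfolding nat_iso_def
    using whisker_right_nat_trans[OF assms(1) iso(1)] whisker_right_nat_trans[OF assms(1) iso(2)]
    by (simp add: whisker_right_def functor_simps[OF assms(1)] iso(3,4))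
qed

text \<open>As \<open>\<tau>\<close> is natural and invertible, \<open>V g\<close> carries the new
  arrow to \<open>f\<close> exactly if \<open>U g\<close> carries \<open>u\<close> to
  \<open>\<sigma> x\<close> after \<open>f\<close>. So the two unique existence statements are about
  the same \<open>g\<close>.\<close>

lemma universal_arrow_iso:
  assumes U: "is_functor D C U" and V: "is_functor D C V" and iso: "nat_iso D C U V \<tau> \<sigma>"
    and c: "c \<in> Obj C" and u: "universal_arrow D C U c d u"
  shows "universal_arrow D C V c d (Comp C c (ob U d) (ob V d) (\<tau> d) u)"
  unfolding universal_arrow_def
proof (intro conjI ballI)
  note Us = functor_simps[OF U] and Vs = functor_simps[OF V]
    and cat = functor_category[OF U] and ud = universal_arrowD[OF u]
  note ins = nat_trans_in[OF nat_isoD(1)[OF iso]] nat_trans_in[OF nat_isoD(2)[OF iso]]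
  show "d \<in> Obj D"
    by (rule ud)
  show "Comp C c (ob U d) (ob V d) (\<tau> d) u \<in> Hom C c (ob V d)"
    using c ud cat by (simp add: Us Vs ins)
  fix x f assume x: "x \<in> Obj D" and f: "f \<in> Hom C c (ob V x)"
  have "Comp C c (ob V d) (ob V x) (ar V d x g) (Comp C c (ob U d) (ob V d) (\<tau> d) u) = f \<longleftrightarrow>
      Comp C c (ob U d) (ob U x) (ar U d x g) u = Comp C c (ob V x) (ob U x) (\<sigma> x) f"
    (is "?l = f \<longleftrightarrow> ?r = _")
    if g: "g \<in> Hom D d x" for g
  proof -
    have "?l = Comp C c (ob U d) (ob V x) (Comp C (ob U d) (ob V d) (ob V x) (ar V d x g) (\<tau> d)) u"
      using g c x ud cat by (simp add: Us Vs ins category_assoc)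
    also have "\<dots> = Comp C c (ob U x) (ob V x) (\<tau> x) ?r"
      using g c x ud cat nat_trans_naturality[OF nat_isoD(1)[OF iso] ud(1) x g]
      by (simp add: Us Vs ins category_assoc flip: nat_trans_naturality[OF nat_isoD(1)[OF iso] ud(1) x g])
    finally have eq: "?l = Comp C c (ob U x) (ob V x) (\<tau> x) ?r" .
    have "?r = Comp C c (ob U x) (ob U x) (Comp C (ob U x) (ob V x) (ob U x) (\<sigma> x) (\<tau> x)) ?r"
      using g c x ud cat by (simp add: Us nat_isoD(3)[OF iso])
    also have "\<dots> = Comp C c (ob V x) (ob U x) (\<sigma> x) ?l"
      unfolding eq using g c x ud cat by (simp add: Us Vs ins category_assoc)
    finally have "?r = Comp C c (ob V x) (ob U x) (\<sigma> x) ?l" .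
    moreover have "Comp C c (ob U x) (ob V x) (\<tau> x) (Comp C c (ob V x) (ob U x) (\<sigma> x) f) =
        Comp C c (ob V x) (ob V x) (Comp C (ob V x) (ob U x) (ob V x) (\<tau> x) (\<sigma> x)) f"
      using c x f cat by (simp add: Us Vs ins category_assoc)
    then have "Comp C c (ob U x) (ob V x) (\<tau> x) (Comp C c (ob V x) (ob U x) (\<sigma> x) f) = f"
      using c x f cat by (simp add: Vs nat_isoD(4)[OF iso])
    ultimately show ?thesis
      using eq by metis
  qed
  moreover have "Comp C c (ob V x) (ob U x) (\<sigma> x) f \<in> Hom C c (ob U x)"
    using c x f cat by (simp add: Us Vs ins)
  then have "\<exists>!g. g \<in> Hom D d x \<and>
      Comp C c (ob U d) (ob U x) (ar U d x g) u = Comp C c (ob V x) (ob U x) (\<sigma> x) f"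
    using u x unfolding universal_arrow_def by blast
  ultimately show "\<exists>!g. g \<in> Hom D d x \<and>
      Comp C c (ob V d) (ob V x) (ar V d x g) (Comp C c (ob U d) (ob V d) (\<tau> d) u) = f"
    by metis
qed

text \<open>Universality of \<open>\<delta> j\<close> turns \<open>\<gamma> j\<close> into an arrow
  from \<open>\<Psi> j\<close> to \<open>\<Phi> j\<close>, and conversely;
  \<open>\<gamma>nat\<close> and \<open>\<delta>nat\<close> make these arrows natural. The values
  lie in opposite categories because the lemma is meant for functors into \<open>pro\<close>, whose
  arrows are reversed natural transformations, with left Kan extensions as the universal
  arrows.\<close>

lemma universal_arrows_nat_iso:
  assumes U: "is_functor D C U" and X: "is_functor J (op_cat C) X"
    and \<Phi>: "is_functor J (op_cat D) \<Phi>" and \<Psi>: "is_functor J (op_cat D) \<Psi>"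
    and \<gamma>: "\<And>j. j \<in> Obj J \<Longrightarrow> universal_arrow D C U (ob X j) (ob \<Phi> j) (\<gamma> j)"
    and \<delta>: "\<And>j. j \<in> Obj J \<Longrightarrow> universal_arrow D C U (ob X j) (ob \<Psi> j) (\<delta> j)"
    and \<gamma>nat: "\<And>i j f. i \<in> Obj J \<Longrightarrow> j \<in> Obj J \<Longrightarrow> f \<in> Hom J i j \<Longrightarrow>
      Comp C (ob X j) (ob X i) (ob U (ob \<Phi> i)) (\<gamma> i) (ar X i j f) =
      Comp C (ob X j) (ob U (ob \<Phi> j)) (ob U (ob \<Phi> i)) (ar U (ob \<Phi> j) (ob \<Phi> i) (ar \<Phi> i j f)) (\<gamma> j)"
    and \<delta>nat: "\<And>i j f. i \<in> Obj J \<Longrightarrow> j \<in> Obj J \<Longrightarrow> f \<in> Hom J i j \<Longrightarrow>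
      Comp C (ob X j) (ob X i) (ob U (ob \<Psi> i)) (\<delta> i) (ar X i j f) =
      Comp C (ob X j) (ob U (ob \<Psi> j)) (ob U (ob \<Psi> i)) (ar U (ob \<Psi> j) (ob \<Psi> i) (ar \<Psi> i j f)) (\<delta> j)"
  shows "\<exists>\<tau> \<sigma>. nat_iso J (op_cat D) \<Phi> \<Psi> \<tau> \<sigma>"
proof -
  note Us = functor_simps[OF U] and Xs = functor_simps[OF X, simplified]
    and \<Phi>s = functor_simps[OF \<Phi>, simplified] and \<Psi>s = functor_simps[OF \<Psi>, simplified]
    and cat = functor_category[OF U]
    and \<gamma>s = universal_arrowD(2)[OF \<gamma>] and \<delta>s = universal_arrowD(2)[OF \<delta>]
  have "\<exists>t. t \<in> Hom D (ob \<Psi> j) (ob \<Phi> j) \<and>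
      Comp C (ob X j) (ob U (ob \<Psi> j)) (ob U (ob \<Phi> j)) (ar U (ob \<Psi> j) (ob \<Phi> j) t) (\<delta> j) = \<gamma> j"
    if "j \<in> Obj J" for j
    using universal_arrow_ex[OF \<delta>[OF that] _ \<gamma>s[OF that]] \<Phi>s(1)[OF that] by metis
  then obtain t where t: "t j \<in> Hom D (ob \<Psi> j) (ob \<Phi> j)"
      "Comp C (ob X j) (ob U (ob \<Psi> j)) (ob U (ob \<Phi> j)) (ar U (ob \<Psi> j) (ob \<Phi> j) (t j)) (\<delta> j) = \<gamma> j"
    if "j \<in> Obj J" for j
    by metis
  have "\<exists>t. t \<in> Hom D (ob \<Phi> j) (ob \<Psi> j) \<and>
      Comp C (ob X j) (ob U (ob \<Phi> j)) (ob U (ob \<Psi> j)) (ar U (ob \<Phi> j) (ob \<Psi> j) t) (\<gamma> j) = \<delta> j"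
    if "j \<in> Obj J" for j
    using universal_arrow_ex[OF \<gamma>[OF that] _ \<delta>s[OF that]] \<Psi>s(1)[OF that] by metis
  then obtain s where s: "s j \<in> Hom D (ob \<Phi> j) (ob \<Psi> j)"
      "Comp C (ob X j) (ob U (ob \<Phi> j)) (ob U (ob \<Psi> j)) (ar U (ob \<Phi> j) (ob \<Psi> j) (s j)) (\<gamma> j) = \<delta> j"
    if "j \<in> Obj J" for j
    by metis
  let ?\<tau> = "\<lambda>j\<in>Obj J. t j" and ?\<sigma> = "\<lambda>j\<in>Obj J. s j"
  have "nat_iso J (op_cat D) \<Phi> \<Psi> ?\<tau> ?\<sigma>"
  proof (rule nat_isoI[OF \<Phi> \<Psi>])
    show "?\<tau> \<in> nat_trans J (op_cat D) \<Phi> \<Psi>"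
    proof (rule nat_transI)
      fix i j f assume *: "i \<in> Obj J" "j \<in> Obj J" "f \<in> Hom J i j"
      have "Comp C (ob X j) (ob U (ob \<Psi> j)) (ob U (ob \<Phi> i)) (ar U (ob \<Psi> j) (ob \<Phi> i)
            (Comp D (ob \<Psi> j) (ob \<Phi> j) (ob \<Phi> i) (ar \<Phi> i j f) (t j))) (\<delta> j) =
          Comp C (ob X j) (ob U (ob \<Phi> j)) (ob U (ob \<Phi> i)) (ar U (ob \<Phi> j) (ob \<Phi> i) (ar \<Phi> i j f)) (\<gamma> j)"
        using * cat by (simp add: Us Xs \<Phi>s \<Psi>s \<delta>s t category_assoc)
      also have "\<dots> = Comp C (ob X j) (ob U (ob \<Psi> i)) (ob U (ob \<Phi> i))
            (ar U (ob \<Psi> i) (ob \<Phi> i) (t i))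
            (Comp C (ob X j) (ob X i) (ob U (ob \<Psi> i)) (\<delta> i) (ar X i j f))"
        using * cat by (simp add: Us Xs \<Phi>s \<Psi>s \<delta>s t \<delta>nat[symmetric] \<gamma>nat[symmetric]
            category_assoc[where f = "ar X i j f", symmetric])
      also have "\<dots> = Comp C (ob X j) (ob U (ob \<Psi> j)) (ob U (ob \<Phi> i)) (ar U (ob \<Psi> j) (ob \<Phi> i)
            (Comp D (ob \<Psi> j) (ob \<Psi> i) (ob \<Phi> i) (t i) (ar \<Psi> i j f))) (\<delta> j)"
        using * cat by (simp add: Us Xs \<Phi>s \<Psi>s \<delta>s t(1) \<delta>nat category_assoc)
      finally show "Comp (op_cat D) (ob \<Phi> i) (ob \<Phi> j) (ob \<Psi> j) (?\<tau> j) (ar \<Phi> i j f) =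
          Comp (op_cat D) (ob \<Phi> i) (ob \<Psi> i) (ob \<Psi> j) (ar \<Psi> i j f) (?\<tau> i)"
        using * cat
        by simp (rule universal_arrow_eq[OF \<delta>[OF *(2)] _ _ _ _ U], simp_all add: \<Phi>s \<Psi>s Xs t)
    qed (simp_all add: t)
    fix j assume j: "j \<in> Obj J"
    show "?\<sigma> j \<in> Hom (op_cat D) (ob \<Psi> j) (ob \<Phi> j)"
      using j by (simp add: s)
    show "Comp (op_cat D) (ob \<Phi> j) (ob \<Psi> j) (ob \<Phi> j) (?\<sigma> j) (?\<tau> j) = Ident (op_cat D) (ob \<Phi> j)"
      using j cat
      by simp (rule universal_arrow_eq[OF \<gamma>[OF j] \<Phi>s(1)[OF j] _ _ _ U], simp_all add: Us \<Phi>s \<Psi>s Xs t s \<gamma>s \<delta>s category_assoc)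
    show "Comp (op_cat D) (ob \<Psi> j) (ob \<Phi> j) (ob \<Psi> j) (?\<tau> j) (?\<sigma> j) = Ident (op_cat D) (ob \<Psi> j)"
      using j cat
      by simp (rule universal_arrow_eq[OF \<delta>[OF j] \<Psi>s(1)[OF j] _ _ _ U], simp_all add: Us \<Phi>s \<Psi>s Xs t s \<gamma>s \<delta>s category_assoc)
  qed simp
  then show ?thesis
    by blast
qed

section \<open>Duality: opposite functors and the existence of right adjoints\<close>

definition op_func :: "('o, 'm, 'p, 'n) func \<Rightarrow> ('o, 'm, 'p, 'n) func" where
  "op_func F = \<lparr>ob = ob F, ar = (\<lambda>a b f. ar F b a f)\<rparr>"

lemma op_func_simps [simp]: "ob (op_func F) = ob F" "ar (op_func F) a b f = ar F b a f"
  by (simp_all add: op_func_def)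

lemma op_op_func [simp]: "op_func (op_func F) = F"
  by (simp add: op_func_def)

lemma op_func_id [simp]: "op_func id_func = id_func"
  by (simp add: op_func_def id_func_def)

lemma op_func_comp: "op_func (G \<odot> F) = op_func G \<odot> op_func F"
  by (simp add: op_func_def comp_func_def)

lemma functor_op:
  assumes "is_functor C D F"
  shows "is_functor (op_cat C) (op_cat D) (op_func F)"
  using functor_category[OF assms] by (simp add: is_functor_def functor_simps[OF assms])

lemma nat_trans_op:
  assumes "\<tau> \<in> nat_trans C D F G"
  shows "\<tau> \<in> nat_trans (op_cat C) (op_cat D) (op_func G) (op_func F)"
  using assms by (intro nat_transI) (auto simp: nat_trans_def PiE_def)

lemma adjunction_op:
  assumes "adjunction C D F U \<eta> \<epsilon>"
  shows "adjunction (op_cat D) (op_cat C) (op_func U) (op_func F) \<epsilon> \<eta>"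
proof -
  note adj = adjunctionD[OF assms]
  show ?thesis
    using functor_op[OF adj(1)] functor_op[OF adj(2)] nat_trans_op[OF adj(3)]
      nat_trans_op[OF adj(4)] adj(5,6)
    by (simp add: adjunction_def op_func_comp)
qed

text \<open>Couniversal arrows are universal arrows of the opposite functor, so this is
  \<open>left_adjoint_exists\<close> read in the opposite categories. It produces the functor from
  formal limits to actual limits.\<close>

lemma right_adjoint_exists:
  assumes F: "is_functor C D F"
    and univ: "\<And>d. d \<in> Obj D \<Longrightarrow> \<exists>c e. c \<in> Obj C \<and> e \<in> Hom D (ob F c) d \<and>
      (\<forall>c'\<in>Obj C. \<forall>f\<in>Hom D (ob F c') d.
         \<exists>!g. g \<in> Hom C c' c \<and> Comp D (ob F c') (ob F c) d e (ar F c' c g) = f)"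
  shows "\<exists>U. is_right_adjoint_of C D F U"
proof -
  have "is_right_adjoint (op_cat D) (op_cat C) (op_func F)"
    by (rule left_adjoint_exists[OF functor_op[OF F]]) (use univ in \<open>simp add: universal_arrow_def\<close>)
  then obtain U \<eta> \<epsilon> where "adjunction (op_cat D) (op_cat C) U (op_func F) \<eta> \<epsilon>"
    unfolding is_right_adjoint_def is_right_adjoint_of_def by blast
  from adjunction_op[OF this] show ?thesis
    unfolding is_right_adjoint_of_def by auto
qed

section \<open>The monad of an adjunction, and fully faithful left adjoints\<close>

lemma adjunction_monad:
  assumes "adjunction C D F U \<eta> \<epsilon>"
  shows "is_monad C (U \<odot> F) \<eta> (induced_mult C F U \<epsilon>)"
proof -
  note adj = adjunctionD[OF assms]
  note Fs = functor_simps[OF adj(1)] and Us = functor_simps[OF adj(2)]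
    and cat = functor_category[OF adj(1)]
    and \<eta> = nat_trans_in[OF adj(3), simplified] and \<epsilon> = nat_trans_in[OF adj(4), simplified]
  note \<epsilon>nat = nat_trans_naturality[OF adj(4), simplified]
  have mu: "induced_mult C F U \<epsilon> \<in> nat_trans C C ((U \<odot> F) \<odot> U \<odot> F) (U \<odot> F)"
    using cat by (intro nat_transI) (simp_all add: induced_mult_def Fs Us \<epsilon> \<epsilon>nat flip: Us(4))
  show ?thesis
    unfolding is_monad_def
    using functor_comp[OF adj(1,2)] adj(3) mu cat
    by (simp add: induced_mult_def Fs Us(1,2,3) \<eta> \<epsilon> \<epsilon>nat adj(5,6) flip: Us(4))
qed

text \<open>Fullness supplies \<open>k c\<close> with \<open>F (k c) = \<epsilon> (F c)\<close>.
  Then \<open>k c\<close> after \<open>\<eta> c\<close> is the identity by faithfulness and one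
  triangle identity, and \<open>\<eta> c\<close> after \<open>k c\<close> is the identity by
  naturality of \<open>\<eta>\<close> and the other one. For the Yoneda embedding this says that the
  actual limit of a representable is the representing object.\<close>

lemma fully_faithful_unit_iso:
  assumes adj: "adjunction C D F U \<eta> \<epsilon>"
    and ff: "\<And>a b. a \<in> Obj C \<Longrightarrow> b \<in> Obj C \<Longrightarrow> bij_betw (ar F a b) (Hom C a b) (Hom D (ob F a) (ob F b))"
  shows "\<exists>\<sigma>. nat_iso C C id_func (U \<odot> F) \<eta> \<sigma>"
proof -
  note ad = adjunctionD[OF adj]
  note Fs = functor_simps[OF ad(1)] and Us = functor_simps[OF ad(2)]
    and cat = functor_category[OF ad(1)]
    and \<eta> = nat_trans_in[OF ad(3), simplified] and \<epsilon> = nat_trans_in[OF ad(4), simplified]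
  have "\<exists>k. k \<in> Hom C (ob U (ob F c)) c \<and> ar F (ob U (ob F c)) c k = \<epsilon> (ob F c)"
    if "c \<in> Obj C" for c
  proof -
    have "\<epsilon> (ob F c) \<in> ar F (ob U (ob F c)) c ` Hom C (ob U (ob F c)) c"
      using ff[of "ob U (ob F c)" c] that by (simp add: bij_betw_def Fs Us \<epsilon>)
    then show ?thesis
      by auto
  qed
  then obtain k where k: "k c \<in> Hom C (ob U (ob F c)) c"
      "ar F (ob U (ob F c)) c (k c) = \<epsilon> (ob F c)" if "c \<in> Obj C" for c
    by metis
  have k\<eta>: "Comp C c (ob U (ob F c)) c (k c) (\<eta> c) = Ident C c" if c: "c \<in> Obj C" for c
  proof (rule inj_onD[OF bij_betw_imp_inj_on[OF ff[OF c c]]])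
    show "ar F c c (Comp C c (ob U (ob F c)) c (k c) (\<eta> c)) = ar F c c (Ident C c)"
      using c cat by (simp add: Fs Us \<eta> k ad(5))
  qed (use c cat in \<open>simp_all add: k \<eta> Fs Us\<close>)
  have "Comp C (ob U (ob F c)) c (ob U (ob F c)) (\<eta> c) (k c) = Ident C (ob U (ob F c))"
    if c: "c \<in> Obj C" for c
  proof -
    let ?c = "ob U (ob F c)"
    have "Comp C ?c c ?c (\<eta> c) (k c) =
        Comp C ?c (ob U (ob F ?c)) ?c (ar U (ob F ?c) (ob F c) (ar F ?c c (k c))) (\<eta> ?c)"
      using nat_trans_naturality[OF ad(3) _ c k(1)[OF c]] c
      by (simp add: Fs Us k)
    also have "\<dots> = Ident C ?c"
      using c ad(6)[of "ob F c"] by (simp add: k Fs)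
    finally show ?thesis .
  qed
  then have "nat_iso C C id_func (U \<odot> F) \<eta> (\<lambda>c\<in>Obj C. k c)"
    using cat by (intro nat_isoI[OF functor_id functor_comp[OF ad(1,2)] ad(3)]) (simp_all add: k k\<eta>)
  then show ?thesis
    by blast
qed

section \<open>Functor categories and restriction along a functor\<close>

lemma func_cat_simps [simp]:
  "Obj (func_cat C D) = {F. is_functor C D F}" "Hom (func_cat C D) = nat_trans C D"
  "Ident (func_cat C D) F = (\<lambda>a\<in>Obj C. Ident D (ob F a))"
  "Comp (func_cat C D) F G H \<tau> \<sigma> = (\<lambda>a\<in>Obj C. Comp D (ob F a) (ob G a) (ob H a) (\<tau> a) (\<sigma> a))"
  by (simp_all add: func_cat_def)

lemma nat_trans_ident:
  assumes "is_functor C D F"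
  shows "(\<lambda>a\<in>Obj C. Ident D (ob F a)) \<in> nat_trans C D F F"
  using functor_category[OF assms]
  by (intro nat_transI) (simp_all add: functor_simps[OF assms])

lemma nat_trans_comp:
  assumes F: "is_functor C D F" and G: "is_functor C D G" and H: "is_functor C D H"
    and \<sigma>: "\<sigma> \<in> nat_trans C D F G" and \<tau>: "\<tau> \<in> nat_trans C D G H"
  shows "(\<lambda>a\<in>Obj C. Comp D (ob F a) (ob G a) (ob H a) (\<tau> a) (\<sigma> a)) \<in> nat_trans C D F H"
proof (rule nat_transI)
  note Fs = functor_simps[OF F] and Gs = functor_simps[OF G] and Hs = functor_simps[OF H]
    and cat = functor_category[OF F] and \<sigma>s = nat_trans_in[OF \<sigma>] and \<tau>s = nat_trans_in[OF \<tau>]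
  let ?\<rho> = "\<lambda>a\<in>Obj C. Comp D (ob F a) (ob G a) (ob H a) (\<tau> a) (\<sigma> a)"
  fix a b f assume *: "a \<in> Obj C" "b \<in> Obj C" "f \<in> Hom C a b"
  have "Comp D (ob F a) (ob F b) (ob H b) (?\<rho> b) (ar F a b f) =
      Comp D (ob F a) (ob G b) (ob H b) (\<tau> b) (Comp D (ob F a) (ob F b) (ob G b) (\<sigma> b) (ar F a b f))"
    using * cat by (simp add: Fs Gs Hs \<sigma>s \<tau>s category_assoc)
  also have "\<dots> = Comp D (ob F a) (ob G a) (ob H b)
      (Comp D (ob G a) (ob G b) (ob H b) (\<tau> b) (ar G a b f)) (\<sigma> a)"
    using * cat nat_trans_naturality[OF \<sigma> *] by (simp add: Fs Gs Hs \<sigma>s \<tau>s category_assoc)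
  also have "\<dots> = Comp D (ob F a) (ob H a) (ob H b) (ar H a b f) (?\<rho> a)"
    using * cat nat_trans_naturality[OF \<tau> *] by (simp add: Fs Gs Hs \<sigma>s \<tau>s category_assoc)
  finally show "Comp D (ob F a) (ob F b) (ob H b) (?\<rho> b) (ar F a b f) =
      Comp D (ob F a) (ob H a) (ob H b) (ar H a b f) (?\<rho> a)" .
qed (use functor_simps[OF F] functor_simps[OF G] functor_simps[OF H] functor_category[OF F]
      nat_trans_in[OF \<sigma>] nat_trans_in[OF \<tau>] in simp_all)

lemma category_func_cat [simp]: "category (func_cat C D)"
  unfolding category_def
proof (intro conjI ballI)
  fix F assume "F \<in> Obj (func_cat C D)"
  then show "Ident (func_cat C D) F \<in> Hom (func_cat C D) F F"
    by (simp add: nat_trans_ident)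
next
  fix F G H \<sigma> \<tau> assume "F \<in> Obj (func_cat C D)" "G \<in> Obj (func_cat C D)" "H \<in> Obj (func_cat C D)"
    "\<sigma> \<in> Hom (func_cat C D) F G" "\<tau> \<in> Hom (func_cat C D) G H"
  then show "Comp (func_cat C D) F G H \<tau> \<sigma> \<in> Hom (func_cat C D) F H"
    by (simp add: nat_trans_comp)
next
  fix F G \<tau>
  assume "F \<in> Obj (func_cat C D)" "G \<in> Obj (func_cat C D)" "\<tau> \<in> Hom (func_cat C D) F G"
  then have *: "is_functor C D F" "is_functor C D G" "\<tau> \<in> nat_trans C D F G"
    by simp_all
  have ext: "\<tau> = (\<lambda>a\<in>Obj C. \<tau> a)"
    using *(3) by (auto simp: nat_trans_def PiE_def extensional_restrict)
  show "Comp (func_cat C D) F F G \<tau> (Ident (func_cat C D) F) = \<tau>"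
    using functor_category[OF *(1)] by (intro trans[OF _ ext[symmetric]]) (auto intro!: restrict_ext
      simp: functor_simps[OF *(1)] functor_simps[OF *(2)] nat_trans_in[OF *(3)])
  show "Comp (func_cat C D) F G G (Ident (func_cat C D) G) \<tau> = \<tau>"
    using functor_category[OF *(1)] by (intro trans[OF _ ext[symmetric]]) (auto intro!: restrict_ext
      simp: functor_simps[OF *(1)] functor_simps[OF *(2)] nat_trans_in[OF *(3)])
next
  fix F G H K \<rho> \<sigma> \<tau>
  assume "F \<in> Obj (func_cat C D)" "G \<in> Obj (func_cat C D)" "H \<in> Obj (func_cat C D)"
    "K \<in> Obj (func_cat C D)" "\<rho> \<in> Hom (func_cat C D) F G" "\<sigma> \<in> Hom (func_cat C D) G H"
    "\<tau> \<in> Hom (func_cat C D) H K"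
  then have *: "is_functor C D F" "is_functor C D G" "is_functor C D H" "is_functor C D K"
    "\<rho> \<in> nat_trans C D F G" "\<sigma> \<in> nat_trans C D G H" "\<tau> \<in> nat_trans C D H K"
    by simp_all
  show "Comp (func_cat C D) F G K (Comp (func_cat C D) G H K \<tau> \<sigma>) \<rho> =
      Comp (func_cat C D) F H K \<tau> (Comp (func_cat C D) F G H \<sigma> \<rho>)"
    using functor_category[OF *(1)]
    by (auto intro!: restrict_ext simp: functor_simps(1)[OF *(1)] functor_simps(1)[OF *(2)]
        functor_simps(1)[OF *(3)] functor_simps(1)[OF *(4)] nat_trans_in[OF *(5)]
        nat_trans_in[OF *(6)] nat_trans_in[OF *(7)] category_assoc)
qed

text \<open>Restriction along \<open>K\<close> is made a functor between functor categories so that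
  a left Kan extension along \<open>K\<close> becomes a universal arrow.\<close>

definition precomp :: "('a, 'm) cat \<Rightarrow> ('a, 'm, 'b, 'n) func \<Rightarrow>
    (('b, 'n, 'e, 'k) func, 'b \<Rightarrow> 'k, ('a, 'm, 'e, 'k) func, 'a \<Rightarrow> 'k) func" where
  "precomp A K = \<lparr>ob = (\<lambda>S. S \<odot> K), ar = (\<lambda>S T \<tau>. whisker_right A \<tau> K)\<rparr>"

lemma precomp_simps [simp]:
  "ob (precomp A K) S = S \<odot> K" "ar (precomp A K) S T \<tau> = whisker_right A \<tau> K"
  by (simp_all add: precomp_def)

lemma precomp_functor:
  assumes "is_functor A B K"
  shows "is_functor (func_cat B E) (func_cat A E) (precomp A K)"
  unfolding is_functor_def
  by (auto simp: functor_comp[OF assms] whisker_right_nat_trans[OF assms])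
    (auto simp: whisker_right_def functor_simps[OF assms] fun_eq_iff)

lemma left_kan_universal_arrow:
  assumes "is_left_kan A B E K X L \<gamma>"
  shows "universal_arrow (func_cat B E) (func_cat A E) (precomp A K) X L \<gamma>"
  using assms by (simp add: is_left_kan_def universal_arrow_def)

section \<open>Codensity monads from codense functors\<close>

text \<open>The hypothesis says that each \<open>R b\<close> is the limit of \<open>X\<close> weighted by \<open>B(b, K-)\<close>.\<close>

lemma pointwise_right_kan:
  assumes K: "is_functor A B K" and X: "is_functor A E X" and R: "is_functor B E R"
    and e: "e \<in> nat_trans A E (R \<odot> K) X"
    and pw: "\<And>b z \<rho>. b \<in> Obj B \<Longrightarrow> z \<in> Obj E \<Longrightarrow>
      (\<And>a f. a \<in> Obj A \<Longrightarrow> f \<in> Hom B b (ob K a) \<Longrightarrow> \<rho> a f \<in> Hom E z (ob X a)) \<Longrightarrow>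
      (\<And>a a' h f. a \<in> Obj A \<Longrightarrow> a' \<in> Obj A \<Longrightarrow> h \<in> Hom A a a' \<Longrightarrow> f \<in> Hom B b (ob K a) \<Longrightarrow>
        Comp E z (ob X a) (ob X a') (ar X a a' h) (\<rho> a f) =
        \<rho> a' (Comp B b (ob K a) (ob K a') (ar K a a' h) f)) \<Longrightarrow>
      \<exists>!u. u \<in> Hom E z (ob R b) \<and> (\<forall>a\<in>Obj A. \<forall>f\<in>Hom B b (ob K a).
        Comp E z (ob R (ob K a)) (ob X a) (e a)
          (Comp E z (ob R b) (ob R (ob K a)) (ar R b (ob K a) f) u) = \<rho> a f)"
  shows "is_right_kan A B E K X R e"
  unfolding is_right_kan_def
proof (intro conjI allI impI ballI)
  note Ks = functor_simps[OF K] and Xs = functor_simps[OF X] and Rs = functor_simps[OF R]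
    and cat = functor_category[OF K] functor_category[OF X]
    and es = nat_trans_in[OF e, simplified] and enat = nat_trans_naturality[OF e, simplified]
  let ?p = "\<lambda>z b a f u. Comp E z (ob R (ob K a)) (ob X a) (e a)
          (Comp E z (ob R b) (ob R (ob K a)) (ar R b (ob K a) f) u)"
  \<comment> \<open>The projections \<open>?p\<close> out of \<open>R b\<close> are jointly monic:
    this is the uniqueness half of \<open>pw\<close>, applied to the family that \<open>u\<close>
    itself induces.\<close>
  have monic: "u = v"
    if b: "b \<in> Obj B" "z \<in> Obj E" and u: "u \<in> Hom E z (ob R b)" and v: "v \<in> Hom E z (ob R b)"
      and eq: "\<And>a f. a \<in> Obj A \<Longrightarrow> f \<in> Hom B b (ob K a) \<Longrightarrow> ?p z b a f u = ?p z b a f v"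
    for b z u v
  proof -
    have "\<exists>!u'. u' \<in> Hom E z (ob R b) \<and>
        (\<forall>a\<in>Obj A. \<forall>f\<in>Hom B b (ob K a). ?p z b a f u' = ?p z b a f u)"
    proof (rule pw[OF b])
      fix a a' h f
      assume *: "a \<in> Obj A" "a' \<in> Obj A" "h \<in> Hom A a a'" "f \<in> Hom B b (ob K a)"
      have "Comp E z (ob X a) (ob X a') (ar X a a' h) (?p z b a f u) =
          Comp E z (ob R (ob K a)) (ob X a') (Comp E (ob R (ob K a)) (ob X a) (ob X a') (ar X a a' h) (e a))
            (Comp E z (ob R b) (ob R (ob K a)) (ar R b (ob K a) f) u)"
        using * b u cat by (simp add: Ks Xs Rs es category_assoc)
      also have "\<dots> = ?p z b a' (Comp B b (ob K a) (ob K a') (ar K a a' h) f) u"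
        using * b u cat by (simp add: Ks Xs Rs es category_assoc flip: enat)
      finally show "Comp E z (ob X a) (ob X a') (ar X a a' h) (?p z b a f u) =
          ?p z b a' (Comp B b (ob K a) (ob K a') (ar K a a' h) f) u" .
    qed (use b u cat in \<open>simp add: Ks Xs Rs es\<close>)
    then show ?thesis
      using u v eq by metis
  qed
  fix S \<sigma> assume S: "is_functor B E S" and \<sigma>: "\<sigma> \<in> nat_trans A E (S \<odot> K) X"
  note Ss = functor_simps[OF S]
    and \<sigma>s = nat_trans_in[OF \<sigma>, simplified] and \<sigma>nat = nat_trans_naturality[OF \<sigma>, simplified]
  \<comment> \<open>The family at \<open>z = S b\<close> is forced: by naturality, any
    \<open>\<tau>\<close> that composes with \<open>e\<close> to \<open>\<sigma>\<close> has
    \<open>\<sigma> a\<close> after \<open>S f\<close> as its projection at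
    \<open>(a, f)\<close>.\<close>
  have "\<exists>u. u \<in> Hom E (ob S b) (ob R b) \<and> (\<forall>a\<in>Obj A. \<forall>f\<in>Hom B b (ob K a).
      ?p (ob S b) b a f u = Comp E (ob S b) (ob S (ob K a)) (ob X a) (\<sigma> a) (ar S b (ob K a) f))"
    if b: "b \<in> Obj B" for b
  proof (rule ex1_implies_ex, rule pw[OF b Ss(1)[OF b]])
    fix a a' h f
    assume *: "a \<in> Obj A" "a' \<in> Obj A" "h \<in> Hom A a a'" "f \<in> Hom B b (ob K a)"
    have "Comp E (ob S b) (ob X a) (ob X a') (ar X a a' h)
          (Comp E (ob S b) (ob S (ob K a)) (ob X a) (\<sigma> a) (ar S b (ob K a) f)) =
        Comp E (ob S b) (ob S (ob K a)) (ob X a')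
          (Comp E (ob S (ob K a)) (ob X a) (ob X a') (ar X a a' h) (\<sigma> a)) (ar S b (ob K a) f)"
      using * b cat by (simp add: Ks Xs Ss \<sigma>s category_assoc)
    also have "\<dots> = Comp E (ob S b) (ob S (ob K a')) (ob X a') (\<sigma> a')
          (ar S b (ob K a') (Comp B b (ob K a) (ob K a') (ar K a a' h) f))"
      using * b cat by (simp add: Ks Xs Ss \<sigma>s category_assoc flip: \<sigma>nat)
    finally show "Comp E (ob S b) (ob X a) (ob X a') (ar X a a' h)
          (Comp E (ob S b) (ob S (ob K a)) (ob X a) (\<sigma> a) (ar S b (ob K a) f)) =
        Comp E (ob S b) (ob S (ob K a')) (ob X a') (\<sigma> a')
          (ar S b (ob K a') (Comp B b (ob K a) (ob K a') (ar K a a' h) f))" .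
  qed (use b cat in \<open>simp add: Ks Xs Ss \<sigma>s\<close>)
  then obtain t where t: "t b \<in> Hom E (ob S b) (ob R b)"
    and pt: "a \<in> Obj A \<Longrightarrow> f \<in> Hom B b (ob K a) \<Longrightarrow> ?p (ob S b) b a f (t b) =
      Comp E (ob S b) (ob S (ob K a)) (ob X a) (\<sigma> a) (ar S b (ob K a) f)"
    if "b \<in> Obj B" for a b f
    by metis
  have tnat: "Comp E (ob S b) (ob S c) (ob R c) (t c) (ar S b c g) =
      Comp E (ob S b) (ob R b) (ob R c) (ar R b c g) (t b)"
    if *: "b \<in> Obj B" "c \<in> Obj B" "g \<in> Hom B b c" for b c g
  proof (rule monic[OF *(2) Ss(1)[OF *(1)]])
    fix a f assume a: "a \<in> Obj A" and f: "f \<in> Hom B c (ob K a)"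
    have "?p (ob S b) c a f (Comp E (ob S b) (ob S c) (ob R c) (t c) (ar S b c g)) =
        Comp E (ob S b) (ob S c) (ob X a) (?p (ob S c) c a f (t c)) (ar S b c g)"
      using * a f cat by (simp add: Ks Xs Ss Rs es t category_assoc del: pt)
    also have "\<dots> = ?p (ob S b) b a (Comp B b c (ob K a) f g) (t b)"
      using * a f cat by (simp add: Ks Xs Ss \<sigma>s pt category_assoc)
    also have "\<dots> = ?p (ob S b) c a f (Comp E (ob S b) (ob R b) (ob R c) (ar R b c g) (t b))"
      using * a f cat by (simp add: Ks Xs Ss Rs es t category_assoc)
    finally show "?p (ob S b) c a f (Comp E (ob S b) (ob S c) (ob R c) (t c) (ar S b c g)) =
        ?p (ob S b) c a f (Comp E (ob S b) (ob R b) (ob R c) (ar R b c g) (t b))" .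
  qed (use * cat in \<open>simp_all add: Ss Rs t\<close>)
  let ?t = "\<lambda>b\<in>Obj B. t b"
  have tn: "?t \<in> nat_trans B E S R"
    by (rule nat_transI) (simp_all add: t tnat)
  show "\<exists>!\<tau>. \<tau> \<in> nat_trans B E S R \<and>
      Comp (func_cat A E) (S \<odot> K) (R \<odot> K) X e (whisker_right A \<tau> K) = \<sigma>"
  proof (rule ex1I[of _ ?t], intro conjI)
    \<comment> \<open>The projection at the identity of \<open>K a\<close> recovers
      \<open>\<sigma> a\<close>.\<close>
    have "Comp E (ob S (ob K a)) (ob R (ob K a)) (ob X a) (e a) (t (ob K a)) = \<sigma> a"
      if "a \<in> Obj A" for a
      using pt[of "ob K a" a "Ident B (ob K a)"] that cat by (simp add: Ks Xs Ss Rs \<sigma>s t)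
    then show "Comp (func_cat A E) (S \<odot> K) (R \<odot> K) X e (whisker_right A ?t K) = \<sigma>"
      using \<sigma> by (auto simp: fun_eq_iff whisker_right_def Ks nat_trans_def PiE_def extensional_def)
  next
    fix \<tau> assume *: "\<tau> \<in> nat_trans B E S R \<and>
      Comp (func_cat A E) (S \<odot> K) (R \<odot> K) X e (whisker_right A \<tau> K) = \<sigma>"
    then have \<tau>: "\<tau> \<in> nat_trans B E S R"
      by blast
    have eq: "Comp E (ob S (ob K a)) (ob R (ob K a)) (ob X a) (e a) (\<tau> (ob K a)) = \<sigma> a"
      if "a \<in> Obj A" for a
      using * that by (auto simp: whisker_right_def)
    note \<tau>s = nat_trans_in[OF \<tau>] and \<tau>nat = nat_trans_naturality[OF \<tau>]
    have "\<tau> b = t b" if b: "b \<in> Obj B" for b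
    proof (rule monic[OF b Ss(1)[OF b] \<tau>s[OF b] t[OF b]])
      fix a f assume *: "a \<in> Obj A" "f \<in> Hom B b (ob K a)"
      then have "?p (ob S b) b a f (\<tau> b) = Comp E (ob S b) (ob S (ob K a)) (ob X a)
          (Comp E (ob S (ob K a)) (ob R (ob K a)) (ob X a) (e a) (\<tau> (ob K a))) (ar S b (ob K a) f)"
        using b cat by (simp add: Ks Xs Ss Rs es \<tau>s category_assoc del: eq flip: \<tau>nat)
      then show "?p (ob S b) b a f (\<tau> b) = ?p (ob S b) b a f (t b)"
        using b * by (simp add: pt eq)
    qed
    then show "\<tau> = ?t"
      by (intro nat_trans_ext[OF \<tau> tn]) simp
  qed (rule tn)
qed (fact K X R e)+

text \<open>\<open>y\<close> is codense if every object \<open>Q\<close> is the limit of \<open>y\<close> weighted by \<open>E(Q, y-)\<close>.\<close>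

definition codense :: "('a, 'm) cat \<Rightarrow> ('e, 'k) cat \<Rightarrow> ('a, 'm, 'e, 'k) func \<Rightarrow> bool" where
  "codense A E y \<longleftrightarrow> is_functor A E y \<and>
    (\<forall>P\<in>Obj E. \<forall>Q\<in>Obj E. \<forall>w.
      (\<forall>a\<in>Obj A. \<forall>v\<in>Hom E Q (ob y a). w a v \<in> Hom E P (ob y a)) \<longrightarrow>
      (\<forall>a\<in>Obj A. \<forall>a'\<in>Obj A. \<forall>h\<in>Hom A a a'. \<forall>v\<in>Hom E Q (ob y a).
        Comp E P (ob y a) (ob y a') (ar y a a' h) (w a v) =
        w a' (Comp E Q (ob y a) (ob y a') (ar y a a' h) v)) \<longrightarrow>
      (\<exists>!t. t \<in> Hom E P Q \<and> (\<forall>a\<in>Obj A. \<forall>v\<in>Hom E Q (ob y a). Comp E P Q (ob y a) v t = w a v)))"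

text \<open>\<open>E\<close> stands for \<open>pro \<DD> A\<close> and \<open>U\<close> for the
  composite to \<open>B\<close>. Both directions of the isomorphism between
  \<open>U \<odot> y\<close> and \<open>G\<close> are fixed, since transposes are formed with
  \<open>\<theta>\<close> and undone with \<open>\<theta>'\<close>.\<close>

locale codense_adjunction =
  fixes A :: "('a, 'm) cat" and B :: "('b, 'n) cat" and E :: "('e, 'k) cat"
    and F :: "('b, 'n, 'e, 'k) func" and U :: "('e, 'k, 'b, 'n) func"
    and \<eta> :: "'b \<Rightarrow> 'n" and \<epsilon> :: "'e \<Rightarrow> 'k"
    and y :: "('a, 'm, 'e, 'k) func" and G :: "('a, 'm, 'b, 'n) func"
    and \<theta> \<theta>' :: "'a \<Rightarrow> 'n"
  assumes adj: "adjunction B E F U \<eta> \<epsilon>" and codense: "codense A E y"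
    and G: "is_functor A B G" and iso: "nat_iso A B (U \<odot> y) G \<theta> \<theta>'"
begin

lemma y: "is_functor A E y"
  using codense by (simp add: codense_def)

lemmas Fs = functor_simps[OF adjunctionD(1)[OF adj]]
  and Us = functor_simps[OF adjunctionD(2)[OF adj]]
  and Gs = functor_simps[OF G] and ys = functor_simps[OF y]
  and cat = functor_category[OF adjunctionD(1)[OF adj]] functor_category(1)[OF G]
  and \<eta> = nat_trans_in[OF adjunctionD(3)[OF adj], simplified]
  and \<eta>nat = nat_trans_naturality[OF adjunctionD(3)[OF adj], simplified]
  and \<epsilon> = nat_trans_in[OF adjunctionD(4)[OF adj], simplified]
  and \<theta> = nat_trans_in[OF nat_isoD(1)[OF iso], simplified]
    nat_trans_in[OF nat_isoD(2)[OF iso], simplified]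
  and \<theta>nat = nat_trans_naturality[OF nat_isoD(1)[OF iso], simplified]
  and \<theta>inv = nat_isoD(3,4)[OF iso, simplified]

text \<open>One direction of the bijection between \<open>E(F b, y a)\<close> and
  \<open>B(b, G a)\<close>, with inverse \<open>untr\<close>. It is natural in \<open>a\<close> by
  \<open>tr_postcomp\<close> and \<open>untr_postcomp\<close>, and in \<open>b\<close> by
  \<open>untr_precomp\<close>.\<close>

definition tr :: "'b \<Rightarrow> 'a \<Rightarrow> 'k \<Rightarrow> 'n" where
  "tr b a v = Comp B b (ob U (ob y a)) (ob G a) (\<theta> a)
     (Comp B b (ob U (ob F b)) (ob U (ob y a)) (ar U (ob F b) (ob y a) v) (\<eta> b))"

definition untr :: "'b \<Rightarrow> 'a \<Rightarrow> 'n \<Rightarrow> 'k" where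
  "untr b a f = Comp E (ob F b) (ob F (ob U (ob y a))) (ob y a) (\<epsilon> (ob y a))
     (ar F b (ob U (ob y a)) (Comp B b (ob G a) (ob U (ob y a)) (\<theta>' a) f))"

lemma tr_in: "b \<in> Obj B \<Longrightarrow> a \<in> Obj A \<Longrightarrow> v \<in> Hom E (ob F b) (ob y a) \<Longrightarrow> tr b a v \<in> Hom B b (ob G a)"
  using cat by (simp add: tr_def Fs Us Gs ys \<eta> \<theta>)

lemma untr_in: "b \<in> Obj B \<Longrightarrow> a \<in> Obj A \<Longrightarrow> f \<in> Hom B b (ob G a) \<Longrightarrow> untr b a f \<in> Hom E (ob F b) (ob y a)"
  using cat by (simp add: untr_def Fs Us Gs ys \<epsilon> \<theta>)

lemma tr_untr:
  assumes "b \<in> Obj B" "a \<in> Obj A" "f \<in> Hom B b (ob G a)"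
  shows "tr b a (untr b a f) = f"
proof -
  have "tr b a (untr b a f) =
      Comp B b (ob U (ob y a)) (ob G a) (\<theta> a) (Comp B b (ob G a) (ob U (ob y a)) (\<theta>' a) f)"
    unfolding tr_def untr_def
    using assms cat by (subst adjunction_transpose(2)[OF adj]) (simp_all add: Us Gs ys \<theta>)
  also have "\<dots> = f"
    using assms cat by (simp add: Us Gs ys \<theta> \<theta>inv flip: category_assoc)
  finally show ?thesis .
qed

lemma untr_tr:
  assumes "b \<in> Obj B" "a \<in> Obj A" "v \<in> Hom E (ob F b) (ob y a)"
  shows "untr b a (tr b a v) = v"
proof -
  let ?f = "Comp B b (ob U (ob F b)) (ob U (ob y a)) (ar U (ob F b) (ob y a) v) (\<eta> b)"
  have f: "?f \<in> Hom B b (ob U (ob y a))"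
    using assms cat by (simp add: Fs Us ys \<eta>)
  then have "Comp B b (ob G a) (ob U (ob y a)) (\<theta>' a) (tr b a v) = ?f"
    unfolding tr_def using assms cat
    by (simp add: Us Gs ys \<theta> \<theta>inv category_assoc[symmetric, where f = ?f])
  then show ?thesis
    unfolding untr_def using adjunction_transpose_inverse[OF adj assms(1) _ assms(3)] assms
    by (simp add: ys)
qed

lemma tr_postcomp:
  assumes "b \<in> Obj B" "a \<in> Obj A" "a' \<in> Obj A" "h \<in> Hom A a a'" "v \<in> Hom E (ob F b) (ob y a)"
  shows "tr b a' (Comp E (ob F b) (ob y a) (ob y a') (ar y a a' h) v) =
    Comp B b (ob G a) (ob G a') (ar G a a' h) (tr b a v)"
proof -
  let ?f = "Comp B b (ob U (ob F b)) (ob U (ob y a)) (ar U (ob F b) (ob y a) v) (\<eta> b)"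
  have f: "?f \<in> Hom B b (ob U (ob y a))"
    using assms cat by (simp add: Fs Us ys \<eta>)
  have "tr b a' (Comp E (ob F b) (ob y a) (ob y a') (ar y a a' h) v) =
      Comp B b (ob U (ob y a)) (ob G a')
        (Comp B (ob U (ob y a)) (ob U (ob y a')) (ob G a') (\<theta> a')
          (ar U (ob y a) (ob y a') (ar y a a' h))) ?f"
    unfolding tr_def using assms cat by (simp add: Fs Us Gs ys \<eta> \<theta> category_assoc)
  also have "\<dots> = Comp B b (ob G a) (ob G a') (ar G a a' h) (tr b a v)"
    unfolding tr_def using assms cat f by (simp add: Us Gs ys \<theta> \<theta>nat category_assoc)
  finally show ?thesis .
qed

lemma untr_postcomp:
  assumes "b \<in> Obj B" "a \<in> Obj A" "a' \<in> Obj A" "h \<in> Hom A a a'" "f \<in> Hom B b (ob G a)"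
  shows "Comp E (ob F b) (ob y a) (ob y a') (ar y a a' h) (untr b a f) =
    untr b a' (Comp B b (ob G a) (ob G a') (ar G a a' h) f)"
proof -
  have "Comp E (ob F b) (ob y a) (ob y a') (ar y a a' h) (untr b a f) \<in> Hom E (ob F b) (ob y a')"
    using assms cat by (simp add: Fs ys untr_in)
  then show ?thesis
    using untr_tr[OF assms(1,3)] tr_postcomp[OF assms(1-4) untr_in[OF assms(1,2,5)]]
      tr_untr[OF assms(1,2,5)] by metis
qed

lemma untr_precomp:
  assumes "b \<in> Obj B" "c \<in> Obj B" "a \<in> Obj A" "g \<in> Hom B c b" "f \<in> Hom B b (ob G a)"
  shows "Comp E (ob F c) (ob F b) (ob y a) (untr b a f) (ar F c b g) = untr c a (Comp B c b (ob G a) f g)"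
  unfolding untr_def using assms cat by (simp add: Fs Us Gs ys \<epsilon> \<theta> category_assoc)

text \<open>\<open>untr\<close> of the identity of \<open>G a\<close> is the arrow
  \<open>F (G a) -> y a\<close> from which, as in the Yoneda lemma, every \<open>untr b a f\<close>
  arises by composing with \<open>F f\<close>. The unit law of the codensity monad is built into
  this choice.\<close>

definition kan_counit :: "'a \<Rightarrow> 'n" where
  "kan_counit = (\<lambda>a\<in>Obj A. Comp B (ob U (ob F (ob G a))) (ob U (ob y a)) (ob G a) (\<theta> a)
     (ar U (ob F (ob G a)) (ob y a) (untr (ob G a) a (Ident B (ob G a)))))"

lemma kan_counit_in: "a \<in> Obj A \<Longrightarrow> kan_counit a \<in> Hom B (ob U (ob F (ob G a))) (ob G a)"
  using cat by (simp add: kan_counit_def Fs Us Gs ys \<theta> untr_in)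

text \<open>As \<open>untr b a f\<close> is the arrow belonging to the identity of
  \<open>G a\<close> composed with \<open>F f\<close>, the projection of the pointwise formula at
  \<open>(a, f)\<close> simplifies to \<open>U (untr b a f)\<close> followed by
  \<open>\<theta> a\<close>.\<close>

lemma kan_counit_precomp:
  assumes "a \<in> Obj A" "b \<in> Obj B" "f \<in> Hom B b (ob G a)" "z \<in> Obj B" "u \<in> Hom B z (ob U (ob F b))"
  shows "Comp B z (ob U (ob F (ob G a))) (ob G a) (kan_counit a)
      (Comp B z (ob U (ob F b)) (ob U (ob F (ob G a))) (ar U (ob F b) (ob F (ob G a)) (ar F b (ob G a) f)) u) =
    Comp B z (ob U (ob y a)) (ob G a) (\<theta> a)
      (Comp B z (ob U (ob F b)) (ob U (ob y a)) (ar U (ob F b) (ob y a) (untr b a f)) u)"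
proof -
  have "untr b a f = Comp E (ob F b) (ob F (ob G a)) (ob y a)
      (untr (ob G a) a (Ident B (ob G a))) (ar F b (ob G a) f)"
    using assms cat by (simp add: untr_precomp Gs)
  then show ?thesis
    using assms cat by (simp add: kan_counit_def Fs Us Gs ys \<theta> untr_in category_assoc)
qed

text \<open>The link to codensity: on the transpose of \<open>t : F c -> F b\<close>, the projection
  at \<open>(a, f)\<close> is, up to the bijection \<open>tr\<close>, the composite of
  \<open>t\<close> with \<open>untr b a f\<close>, and codensity is about such composites.\<close>

lemma kan_counit_transpose:
  assumes "a \<in> Obj A" "b \<in> Obj B" "f \<in> Hom B b (ob G a)" "c \<in> Obj B" "t \<in> Hom E (ob F c) (ob F b)"
  shows "Comp B c (ob U (ob F (ob G a))) (ob G a) (kan_counit a)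
      (Comp B c (ob U (ob F b)) (ob U (ob F (ob G a))) (ar U (ob F b) (ob F (ob G a)) (ar F b (ob G a) f))
        (Comp B c (ob U (ob F c)) (ob U (ob F b)) (ar U (ob F c) (ob F b) t) (\<eta> c))) =
    tr c a (Comp E (ob F c) (ob F b) (ob y a) (untr b a f) t)"
  using assms cat by (simp add: kan_counit_precomp tr_def Fs Us Gs ys \<eta> untr_in category_assoc)

text \<open>Both ways around the square equal \<open>\<theta> a'\<close> after \<open>U\<close> of
  \<open>untr (ob G a) a' (ar G a a' h)\<close>: one by naturality of \<open>untr\<close> in the
  object of \<open>B\<close>, the other by its naturality in the object of \<open>A\<close> and that
  of \<open>\<theta>\<close>.\<close>

lemma kan_counit_nat: "kan_counit \<in> nat_trans A B ((U \<odot> F) \<odot> G) G"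
proof (rule nat_transI)
  fix a a' h assume *: "a \<in> Obj A" "a' \<in> Obj A" "h \<in> Hom A a a'"
  let ?R = "\<lambda>b. ob U (ob F b)"
  let ?k = "untr (ob G a) a (Ident B (ob G a))"
  have k: "?k \<in> Hom E (ob F (ob G a)) (ob y a)"
    using * cat by (simp add: untr_in Gs)
  have Ik: "Comp B (?R (ob G a)) (?R (ob G a)) (?R (ob G a')) u (Ident B (?R (ob G a))) = u"
    if "u \<in> Hom B (?R (ob G a)) (?R (ob G a'))" for u
    using that * cat by (simp add: Fs Us Gs)
  have "Comp B (?R (ob G a)) (?R (ob G a')) (ob G a') (kan_counit a')
        (ar U (ob F (ob G a)) (ob F (ob G a')) (ar F (ob G a) (ob G a') (ar G a a' h))) =
      Comp B (?R (ob G a)) (ob U (ob y a')) (ob G a') (\<theta> a')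
        (ar U (ob F (ob G a)) (ob y a') (untr (ob G a) a' (ar G a a' h)))"
    using kan_counit_precomp[OF *(2) _ Gs(2)[OF *], of "?R (ob G a)" "Ident B (?R (ob G a))"] * cat
    by (simp add: Fs Us Gs ys untr_in)
  also have "untr (ob G a) a' (ar G a a' h) = Comp E (ob F (ob G a)) (ob y a) (ob y a') (ar y a a' h) ?k"
    using * cat by (simp add: untr_postcomp Gs)
  also have "Comp B (?R (ob G a)) (ob U (ob y a')) (ob G a') (\<theta> a')
        (ar U (ob F (ob G a)) (ob y a') (Comp E (ob F (ob G a)) (ob y a) (ob y a') (ar y a a' h) ?k)) =
      Comp B (?R (ob G a)) (ob U (ob y a)) (ob G a')
        (Comp B (ob U (ob y a)) (ob U (ob y a')) (ob G a') (\<theta> a')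
          (ar U (ob y a) (ob y a') (ar y a a' h))) (ar U (ob F (ob G a)) (ob y a) ?k)"
    using * k cat by (simp add: Fs Us Gs ys \<theta> category_assoc)
  also have "\<dots> = Comp B (?R (ob G a)) (ob G a) (ob G a') (ar G a a' h) (kan_counit a)"
    using * k cat by (simp add: kan_counit_def Fs Us Gs ys \<theta> \<theta>nat category_assoc)
  finally show "Comp B (ob ((U \<odot> F) \<odot> G) a) (ob ((U \<odot> F) \<odot> G) a') (ob G a')
      (kan_counit a') (ar ((U \<odot> F) \<odot> G) a a' h) =
    Comp B (ob ((U \<odot> F) \<odot> G) a) (ob G a) (ob G a') (ar G a a' h) (kan_counit a)"
    by simp
qed (simp_all add: kan_counit_in, simp add: kan_counit_def)

text \<open>Conjugating a natural family \<open>\<rho>\<close> by the bijection \<open>tr\<close>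
  gives a natural family on the arrows from \<open>F b\<close> to the objects \<open>y a\<close>.
  Codensity represents it by a unique \<open>t : F z -> F b\<close>, and the transpose of
  \<open>t\<close> is the required arrow.\<close>

lemma kan_counit_right_kan: "is_right_kan A B B G G (U \<odot> F) kan_counit"
proof (rule pointwise_right_kan[OF G G functor_comp[OF adjunctionD(1,2)[OF adj]] kan_counit_nat])
  fix b z \<rho> assume b: "b \<in> Obj B" and z: "z \<in> Obj B"
    and \<rho>: "\<And>a f. a \<in> Obj A \<Longrightarrow> f \<in> Hom B b (ob G a) \<Longrightarrow> \<rho> a f \<in> Hom B z (ob G a)"
    and \<rho>nat: "\<And>a a' h f. a \<in> Obj A \<Longrightarrow> a' \<in> Obj A \<Longrightarrow> h \<in> Hom A a a' \<Longrightarrow> f \<in> Hom B b (ob G a) \<Longrightarrow>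
      Comp B z (ob G a) (ob G a') (ar G a a' h) (\<rho> a f) =
      \<rho> a' (Comp B b (ob G a) (ob G a') (ar G a a' h) f)"
  let ?P = "\<lambda>u. u \<in> Hom B z (ob U (ob F b)) \<and> (\<forall>a\<in>Obj A. \<forall>f\<in>Hom B b (ob G a).
        Comp B z (ob U (ob F (ob G a))) (ob G a) (kan_counit a)
          (Comp B z (ob U (ob F b)) (ob U (ob F (ob G a)))
            (ar U (ob F b) (ob F (ob G a)) (ar F b (ob G a) f)) u) = \<rho> a f)"
  let ?w = "\<lambda>a v. untr z a (\<rho> a (tr b a v))"
  let ?T = "\<lambda>t. t \<in> Hom E (ob F z) (ob F b) \<and>
      (\<forall>a\<in>Obj A. \<forall>v\<in>Hom E (ob F b) (ob y a). Comp E (ob F z) (ob F b) (ob y a) v t = ?w a v)"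
  let ?u = "\<lambda>t. Comp B z (ob U (ob F z)) (ob U (ob F b)) (ar U (ob F z) (ob F b) t) (\<eta> z)"
  have "\<exists>!t. ?T t"
    using codense b z by (simp add: codense_def Fs untr_in \<rho> tr_in untr_postcomp \<rho>nat tr_postcomp)
  then obtain t where t: "?T t" and t_unique: "\<And>t'. ?T t' \<Longrightarrow> t' = t"
    by blast
  have P_iff: "?P (?u t) \<longleftrightarrow> ?T t" if t: "t \<in> Hom E (ob F z) (ob F b)" for t
  proof
    assume P: "?P (?u t)"
    have "Comp E (ob F z) (ob F b) (ob y a) v t = ?w a v"
      if a: "a \<in> Obj A" and v: "v \<in> Hom E (ob F b) (ob y a)" for a v
    proof -
      have "tr z a (Comp E (ob F z) (ob F b) (ob y a) v t) = \<rho> a (tr b a v)"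
        using P kan_counit_transpose[OF a b tr_in[OF b a v] z t] untr_tr[OF b a v] tr_in[OF b a v] a
        by simp
      moreover have "Comp E (ob F z) (ob F b) (ob y a) v t \<in> Hom E (ob F z) (ob y a)"
        using a b z t v cat by (simp add: Fs ys)
      ultimately show ?thesis
        using untr_tr[OF z a] by metis
    qed
    then show "?T t"
      using t by simp
  next
    assume "?T t"
    then show "?P (?u t)"
      using b z t cat by (simp add: kan_counit_transpose tr_untr untr_in \<rho> Fs Us \<eta>)
  qed
  have "\<exists>!u. ?P u"
  proof (rule ex1I[of _ "?u t"])
    show "?P (?u t)"
      using P_iff[of t] t by blast
    fix u assume u: "?P u"
    \<comment> \<open>Every \<open>u\<close> is the transpose of some \<open>t'\<close>, so the
      uniqueness of \<open>t\<close> passes to \<open>?u t\<close>.\<close>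
    obtain t' where t': "t' \<in> Hom E (ob F z) (ob F b)" "?u t' = u"
      using adjunction_transpose[OF adj z Fs(1)[OF b]] u by metis
    show "u = ?u t"
      using t_unique[of t'] P_iff[OF t'(1)] u unfolding t'(2) using t'(2) by blast
  qed
  then show "\<exists>!u. u \<in> Hom B z (ob (U \<odot> F) b) \<and> (\<forall>a\<in>Obj A. \<forall>f\<in>Hom B b (ob G a).
        Comp B z (ob (U \<odot> F) (ob G a)) (ob G a) (kan_counit a)
          (Comp B z (ob (U \<odot> F) b) (ob (U \<odot> F) (ob G a)) (ar (U \<odot> F) b (ob G a) f) u) = \<rho> a f)"
    by simp
qed

text \<open>The unit law is \<open>kan_counit_transpose\<close> for two identities. For the
  multiplication, composing with \<open>kan_counit a\<close> factors through \<open>U ?k\<close>, so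
  it is enough that \<open>?k\<close> after \<open>\<epsilon>\<close> equals \<open>?k\<close> after
  \<open>F (kan_counit a)\<close>; both are \<open>untr\<close> of
  \<open>kan_counit a\<close>.\<close>

lemma codensity_monad: "is_codensity_monad A B G (U \<odot> F) \<eta> (induced_mult B F U \<epsilon>)"
  unfolding is_codensity_monad_def
proof (intro conjI exI[of _ kan_counit])
  show "is_monad B (U \<odot> F) \<eta> (induced_mult B F U \<epsilon>)"
    by (rule adjunction_monad[OF adj])
  show "is_right_kan A B B G G (U \<odot> F) kan_counit"
    by (rule kan_counit_right_kan)
  have unit: "Comp B (ob G a) (ob U (ob F (ob G a))) (ob G a) (kan_counit a) (\<eta> (ob G a)) =
      Ident B (ob G a)" if a: "a \<in> Obj A" for a
    using kan_counit_transpose[OF a Gs(1)[OF a] _ Gs(1)[OF a],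
        of "Ident B (ob G a)" "Ident E (ob F (ob G a))"] a cat
    by (simp add: Fs Us Gs ys \<eta> untr_in tr_untr)
  then show "Comp (func_cat A B) G ((U \<odot> F) \<odot> G) G kan_counit (whisker_right A \<eta> G) =
      Ident (func_cat A B) G"
    by (auto simp: whisker_right_def intro!: restrict_ext)
  have "Comp B (ob U (ob F (ob U (ob F (ob G a))))) (ob U (ob F (ob G a))) (ob G a) (kan_counit a)
        (ar U (ob F (ob U (ob F (ob G a)))) (ob F (ob G a)) (\<epsilon> (ob F (ob G a)))) =
      Comp B (ob U (ob F (ob U (ob F (ob G a))))) (ob U (ob F (ob G a))) (ob G a) (kan_counit a)
        (ar U (ob F (ob U (ob F (ob G a)))) (ob F (ob G a))
          (ar F (ob U (ob F (ob G a))) (ob G a) (kan_counit a)))"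
    (is "Comp B ?TT ?T _ _ ?l = Comp B ?TT ?T _ _ ?r")
    if a: "a \<in> Obj A" for a
  proof -
    let ?k = "untr (ob G a) a (Ident B (ob G a))"
    have k: "?k \<in> Hom E (ob F (ob G a)) (ob y a)"
      using a cat by (simp add: untr_in Gs)
    \<comment> \<open>Transposing \<open>?k\<close> after \<open>\<epsilon>\<close> creates
      \<open>U \<epsilon>\<close> after \<open>\<eta>\<close>, which a triangle identity removes.
      What remains is the definition of \<open>kan_counit a\<close>.\<close>
    have tr: "tr ?T a (Comp E (ob F ?T) (ob F (ob G a)) (ob y a) ?k (\<epsilon> (ob F (ob G a)))) = kan_counit a"
    proof -
      have "tr ?T a (Comp E (ob F ?T) (ob F (ob G a)) (ob y a) ?k (\<epsilon> (ob F (ob G a)))) =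
          Comp B ?T (ob U (ob y a)) (ob G a) (\<theta> a)
            (Comp B ?T ?T (ob U (ob y a)) (ar U (ob F (ob G a)) (ob y a) ?k)
              (Comp B ?T ?TT ?T ?l (\<eta> ?T)))"
        unfolding tr_def using a k cat by (simp add: Fs Us Gs ys \<eta> \<epsilon> category_assoc)
      also have "\<dots> = kan_counit a"
        using a k cat adjunctionD(6)[OF adj Fs(1)[OF Gs(1)[OF a]]]
        by (simp add: kan_counit_def Fs Us Gs ys)
      finally show ?thesis .
    qed
    have "Comp E (ob F ?T) (ob F (ob G a)) (ob y a) ?k (\<epsilon> (ob F (ob G a))) = untr ?T a (kan_counit a)"
      using untr_tr[of ?T a "Comp E (ob F ?T) (ob F (ob G a)) (ob y a) ?k (\<epsilon> (ob F (ob G a)))"] tr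
        a k cat by (simp add: Fs Us Gs ys \<epsilon>)
    moreover have "\<dots> = Comp E (ob F ?T) (ob F (ob G a)) (ob y a) ?k (ar F ?T (ob G a) (kan_counit a))"
      using a cat by (simp add: untr_precomp Fs Us Gs kan_counit_in)
    ultimately have "ar U (ob F ?T) (ob y a) (Comp E (ob F ?T) (ob F (ob G a)) (ob y a) ?k (\<epsilon> (ob F (ob G a)))) =
        ar U (ob F ?T) (ob y a) (Comp E (ob F ?T) (ob F (ob G a)) (ob y a) ?k (ar F ?T (ob G a) (kan_counit a)))"
      by simp
    then have "Comp B ?TT ?T (ob U (ob y a)) (ar U (ob F (ob G a)) (ob y a) ?k) ?l =
        Comp B ?TT ?T (ob U (ob y a)) (ar U (ob F (ob G a)) (ob y a) ?k) ?r"
      using a k cat by (simp add: Fs Us Gs ys \<epsilon> kan_counit_in)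
    moreover have "Comp B ?TT ?T (ob G a) (kan_counit a) x = Comp B ?TT (ob U (ob y a)) (ob G a) (\<theta> a)
        (Comp B ?TT ?T (ob U (ob y a)) (ar U (ob F (ob G a)) (ob y a) ?k) x)"
      if "x \<in> Hom B ?TT ?T" for x
      using that a k cat by (simp add: kan_counit_def Fs Us Gs ys \<theta> category_assoc)
    ultimately show ?thesis
      using a cat by (simp add: Fs Us Gs \<epsilon> kan_counit_in)
  qed
  then show "Comp (func_cat A B) ((U \<odot> F) \<odot> (U \<odot> F) \<odot> G) ((U \<odot> F) \<odot> G) G kan_counit
        (whisker_right A (induced_mult B F U \<epsilon>) G) =
      Comp (func_cat A B) ((U \<odot> F) \<odot> (U \<odot> F) \<odot> G) ((U \<odot> F) \<odot> G) G kan_counit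
        (whisker_left A (U \<odot> F) ((U \<odot> F) \<odot> G) G kan_counit)"
    by (auto simp: whisker_right_def whisker_left_def induced_mult_def Gs intro!: restrict_ext)
qed

end

section \<open>The Yoneda embedding\<close>

lemma set_cat_simps [simp]:
  "Obj set_cat = {X :: 'u set. small TYPE('u) X}" "Hom set_cat X Y = X \<rightarrow>\<^sub>E Y"
  "Ident set_cat X = (\<lambda>x\<in>X. x)" "Comp set_cat X Y Z g f = compose X g f"
  by (simp_all add: set_cat_def)

lemma category_set_cat [simp]: "category set_cat"
  unfolding category_def
  by (auto simp: compose_def fun_eq_iff PiE_def Pi_def extensional_def)

lemma set_functor_simps:
  assumes "is_functor A set_cat P"
  shows "a \<in> Obj A \<Longrightarrow> b \<in> Obj A \<Longrightarrow> f \<in> Hom A a b \<Longrightarrow> x \<in> ob P a \<Longrightarrow> ar P a b f x \<in> ob P b"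
    "a \<in> Obj A \<Longrightarrow> x \<in> ob P a \<Longrightarrow> ar P a a (Ident A a) x = x"
    "a \<in> Obj A \<Longrightarrow> b \<in> Obj A \<Longrightarrow> c \<in> Obj A \<Longrightarrow> f \<in> Hom A a b \<Longrightarrow> g \<in> Hom A b c \<Longrightarrow>
      x \<in> ob P a \<Longrightarrow> ar P a c (Comp A a b c g f) x = ar P b c g (ar P a b f x)"
  using functor_simps[OF assms] by (auto simp: compose_def PiE_def Pi_def)

lemma nat_set_in:
  "\<tau> \<in> nat_trans A set_cat P Q \<Longrightarrow> a \<in> Obj A \<Longrightarrow> x \<in> ob P a \<Longrightarrow> \<tau> a x \<in> ob Q a"
  using nat_trans_in[of \<tau> A set_cat P Q a] by auto

lemma nat_set_naturality:
  assumes "\<tau> \<in> nat_trans A set_cat P Q" "a \<in> Obj A" "b \<in> Obj A" "f \<in> Hom A a b" "x \<in> ob P a"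
  shows "\<tau> b (ar P a b f x) = ar Q a b f (\<tau> a x)"
  using fun_cong[OF nat_trans_naturality[OF assms(1-4)], of x] assms(5) by (simp add: compose_def)

lemma nat_setI:
  assumes P: "is_functor A set_cat P" and Q: "is_functor A set_cat Q"
    and "\<tau> \<in> extensional (Obj A)" "\<And>a. a \<in> Obj A \<Longrightarrow> \<tau> a \<in> ob P a \<rightarrow>\<^sub>E ob Q a"
    and nat: "\<And>a b f x. a \<in> Obj A \<Longrightarrow> b \<in> Obj A \<Longrightarrow> f \<in> Hom A a b \<Longrightarrow> x \<in> ob P a \<Longrightarrow>
      \<tau> b (ar P a b f x) = ar Q a b f (\<tau> a x)"
  shows "\<tau> \<in> nat_trans A set_cat P Q"
  by (rule nat_transI) (use assms in \<open>simp_all add: compose_def fun_eq_iff\<close>)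

lemma nat_set_ext:
  assumes "\<tau> \<in> nat_trans A set_cat P Q" "\<sigma> \<in> nat_trans A set_cat P Q"
    "\<And>a x. a \<in> Obj A \<Longrightarrow> x \<in> ob P a \<Longrightarrow> \<tau> a x = \<sigma> a x"
  shows "\<tau> = \<sigma>"
proof (rule nat_trans_ext[OF assms(1,2)])
  fix a assume a: "a \<in> Obj A"
  show "\<tau> a = \<sigma> a"
    using nat_trans_in[OF assms(1) a] nat_trans_in[OF assms(2) a] assms(3)[OF a]
    by (auto intro: PiE_ext)
qed

lemma hom_func_simps [simp]:
  "ob (hom_func A a) = Hom A a"
  "ar (hom_func A a) b c g = (\<lambda>f\<in>Hom A a b. Comp A a b c g f)"
  by (simp_all add: hom_func_def)

lemma hom_func_functor:
  assumes "locally_small A" "a \<in> Obj A"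
  shows "is_functor A set_cat (hom_func A a)"
  using assms unfolding is_functor_def locally_small_def
  by (auto simp: compose_def category_assoc fun_eq_iff)

text \<open>The transformation that the Yoneda lemma assigns to an element \<open>x\<close> of
  \<open>P a\<close>. Read in the opposite category, these are the arrows from \<open>P\<close> to
  the representable of \<open>a\<close>.\<close>

definition yoneda_elem ::
    "('a, 'u) cat \<Rightarrow> ('a, 'u, 'u set, 'u \<Rightarrow> 'u) func \<Rightarrow> 'a \<Rightarrow> 'u \<Rightarrow> 'a \<Rightarrow> 'u \<Rightarrow> 'u" where
  "yoneda_elem A P a x = (\<lambda>c\<in>Obj A. \<lambda>g\<in>Hom A a c. ar P a c g x)"

lemma yoneda_elem_in:
  assumes "locally_small A" "is_functor A set_cat P" "a \<in> Obj A" "x \<in> ob P a"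
  shows "yoneda_elem A P a x \<in> nat_trans A set_cat (hom_func A a) P"
proof (rule nat_setI[OF hom_func_functor[OF assms(1,3)] assms(2)])
  have "category A"
    using assms(1) by (simp add: locally_small_def)
  then show "yoneda_elem A P a x c (ar (hom_func A a) b c f g) = ar P b c f (yoneda_elem A P a x b g)"
    if "b \<in> Obj A" "c \<in> Obj A" "f \<in> Hom A b c" "g \<in> ob (hom_func A a) b" for b c f g
    using that assms by (simp add: yoneda_elem_def set_functor_simps[OF assms(2)])
qed (use assms in \<open>auto simp: yoneda_elem_def set_functor_simps[OF assms(2)]\<close>)

lemma yoneda_elem_ident:
  assumes "category A" "is_functor A set_cat P" "a \<in> Obj A" "x \<in> ob P a"
  shows "yoneda_elem A P a x a (Ident A a) = x"
  using assms by (simp add: yoneda_elem_def set_functor_simps[OF assms(2)])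

lemma nat_hom_apply:
  assumes "category A" "\<tau> \<in> nat_trans A set_cat (hom_func A a) P" "a \<in> Obj A" "c \<in> Obj A"
    "g \<in> Hom A a c"
  shows "\<tau> c g = ar P a c g (\<tau> a (Ident A a))"
  using nat_set_naturality[OF assms(2,3,4,5), of "Ident A a"] assms by simp

lemma nat_hom_eq:
  assumes "category A" "\<tau> \<in> nat_trans A set_cat (hom_func A a) P"
    "\<sigma> \<in> nat_trans A set_cat (hom_func A a) P" "a \<in> Obj A"
    "\<tau> a (Ident A a) = \<sigma> a (Ident A a)"
  shows "\<tau> = \<sigma>"
  by (rule nat_set_ext[OF assms(2,3)])
    (use nat_hom_apply[OF assms(1,2)] nat_hom_apply[OF assms(1,3)] assms(4,5) in simp)

lemma nat_hom_eq_yoneda_elem: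
  assumes "locally_small A" "is_functor A set_cat P" "a \<in> Obj A"
    "\<tau> \<in> nat_trans A set_cat (hom_func A a) P"
  shows "\<tau> = yoneda_elem A P a (\<tau> a (Ident A a))"
proof -
  have cat: "category A"
    using assms(1) by (simp add: locally_small_def)
  have "\<tau> a (Ident A a) \<in> ob P a"
    using nat_set_in[OF assms(4,3)] assms(3) cat by simp
  then show ?thesis
    by (intro nat_hom_eq[OF cat assms(4) yoneda_elem_in[OF assms(1-3)] assms(3)])
      (simp_all add: yoneda_elem_ident[OF cat assms(2,3)])
qed

lemma yoneda_simps [simp]:
  "ob (yoneda A) = hom_func A"
  "ar (yoneda A) a b f = (\<lambda>c\<in>Obj A. \<lambda>g\<in>Hom A b c. Comp A a b c g f)"
  by (simp_all add: yoneda_def)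

lemma yoneda_arrow_in:
  assumes "locally_small A" "a \<in> Obj A" "b \<in> Obj A" "f \<in> Hom A a b"
  shows "(\<lambda>c\<in>Obj A. \<lambda>g\<in>Hom A b c. Comp A a b c g f) \<in>
    nat_trans A set_cat (hom_func A b) (hom_func A a)"
  using yoneda_elem_in[OF assms(1) hom_func_functor[OF assms(1,2)] assms(3), of f] assms(4)
  by (simp add: yoneda_elem_def cong: restrict_cong)

lemma func_set_comp_apply:
  "a \<in> Obj A \<Longrightarrow> x \<in> ob P a \<Longrightarrow> Comp (func_cat A set_cat) P Q R \<tau> \<sigma> a x = \<tau> a (\<sigma> a x)"
  by (simp add: compose_def)

lemma yoneda_functor_op:
  assumes "locally_small A"
  shows "is_functor A (op_cat (func_cat A set_cat)) (yoneda A)"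
proof -
  have cat: "category A"
    using assms by (simp add: locally_small_def)
  then show ?thesis
    unfolding is_functor_def
    by (auto simp: hom_func_functor[OF assms] yoneda_arrow_in[OF assms] compose_def
        category_assoc fun_eq_iff simp del: yoneda_simps(2))
      (auto simp: hom_func_functor[OF assms] yoneda_arrow_in[OF assms] compose_def
        category_assoc fun_eq_iff)
qed

lemma yoneda_functor:
  assumes "locally_small A" "\<And>a. a \<in> Obj A \<Longrightarrow> \<Phi> (hom_func A a)"
  shows "is_functor A (full_subcat (op_cat (func_cat A set_cat)) \<Phi>) (yoneda A)"
  by (rule functor_into_full_subcat[OF yoneda_functor_op[OF assms(1)]]) (simp add: assms(2))

lemma yoneda_fully_faithful:
  assumes ls: "locally_small A" and a: "a \<in> Obj A" and b: "b \<in> Obj A"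
  shows "bij_betw (ar (yoneda A) a b) (Hom A a b) (nat_trans A set_cat (hom_func A b) (hom_func A a))"
proof (rule bij_betwI)
  have cat: "category A"
    using ls by (simp add: locally_small_def)
  show "ar (yoneda A) a b \<in> Hom A a b \<rightarrow> nat_trans A set_cat (hom_func A b) (hom_func A a)"
    using yoneda_arrow_in[OF ls a b] by simp
  show "(\<lambda>\<tau>. \<tau> b (Ident A b)) \<in> nat_trans A set_cat (hom_func A b) (hom_func A a) \<rightarrow> Hom A a b"
    using nat_set_in[of _ A "hom_func A b" "hom_func A a" b "Ident A b"] cat b by simp
  show "ar (yoneda A) a b f b (Ident A b) = f" if "f \<in> Hom A a b" for f
    using that a b cat by simp
  fix \<tau> assume \<tau>: "\<tau> \<in> nat_trans A set_cat (hom_func A b) (hom_func A a)"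
  have "\<tau> b (Ident A b) \<in> Hom A a b"
    using nat_set_in[OF \<tau> b, of "Ident A b"] b cat by simp
  then show "ar (yoneda A) a b (\<tau> b (Ident A b)) = \<tau>"
    by (subst (2) nat_hom_eq_yoneda_elem[OF ls hom_func_functor[OF ls a] b \<tau>])
      (simp add: yoneda_elem_def cong: restrict_cong)
qed

text \<open>In the opposite category, arrows from \<open>Q\<close> to the representable of
  \<open>a\<close> are elements of \<open>Q a\<close>. So \<open>w\<close> sends elements of
  \<open>Q a\<close> to elements of \<open>P a\<close>, and its naturality makes it a transformation
  from \<open>Q\<close> to \<open>P\<close>, which is an arrow from \<open>P\<close> to
  \<open>Q\<close>. Fullness of the subcategory is enough for this, hence the arbitrary
  \<open>\<Phi>\<close>.\<close>

lemma yoneda_codense: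
  assumes ls: "locally_small A" and \<Phi>: "\<And>a. a \<in> Obj A \<Longrightarrow> \<Phi> (hom_func A a)"
  shows "codense A (full_subcat (op_cat (func_cat A set_cat)) \<Phi>) (yoneda A)"
  unfolding codense_def
proof (intro conjI ballI allI impI)
  let ?F = "func_cat A set_cat"
  let ?E = "full_subcat (op_cat ?F) \<Phi>"
  have cat: "category A"
    using ls by (simp add: locally_small_def)
  show "is_functor A ?E (yoneda A)"
    using yoneda_functor[of A \<Phi>] ls \<Phi> by simp
  fix P Q w assume "P \<in> Obj ?E" "Q \<in> Obj ?E"
    and "\<forall>a\<in>Obj A. \<forall>v\<in>Hom ?E Q (ob (yoneda A) a). w a v \<in> Hom ?E P (ob (yoneda A) a)"
    and wnat0: "\<forall>a\<in>Obj A. \<forall>a'\<in>Obj A. \<forall>h\<in>Hom A a a'. \<forall>v\<in>Hom ?E Q (ob (yoneda A) a).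
        Comp ?E P (ob (yoneda A) a) (ob (yoneda A) a') (ar (yoneda A) a a' h) (w a v) =
        w a' (Comp ?E Q (ob (yoneda A) a) (ob (yoneda A) a') (ar (yoneda A) a a' h) v)"
  then have P: "is_functor A set_cat P" and Q: "is_functor A set_cat Q"
    and w: "\<And>a v. a \<in> Obj A \<Longrightarrow> v \<in> nat_trans A set_cat (hom_func A a) Q \<Longrightarrow>
        w a v \<in> nat_trans A set_cat (hom_func A a) P"
    by simp_all
  have wnat: "w a' (Comp ?F (hom_func A a') (hom_func A a) Q v (ar (yoneda A) a a' h)) =
      Comp ?F (hom_func A a') (hom_func A a) P (w a v) (ar (yoneda A) a a' h)"
    if "a \<in> Obj A" "a' \<in> Obj A" "h \<in> Hom A a a'" "v \<in> nat_trans A set_cat (hom_func A a) Q" for a a' h v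
    using bspec[OF bspec[OF bspec[OF bspec[OF wnat0]]], of a a' h v] that
    by (simp del: func_cat_simps(4) yoneda_simps(2))
  \<comment> \<open>Moving an element along \<open>h\<close> amounts to composing its transformation
    with the Yoneda image of \<open>h\<close>. In this form the naturality of \<open>w\<close>
    applies to elements.\<close>
  have shift: "yoneda_elem A Q a' (ar Q a a' h x) =
      Comp ?F (hom_func A a') (hom_func A a) Q (yoneda_elem A Q a x) (ar (yoneda A) a a' h)"
    if "a \<in> Obj A" "a' \<in> Obj A" "h \<in> Hom A a a'" "x \<in> ob Q a" for a a' h x
    using that cat by (simp add: yoneda_elem_def compose_def set_functor_simps[OF Q] fun_eq_iff)
  define t where "t = (\<lambda>a\<in>Obj A. \<lambda>x\<in>ob Q a. w a (yoneda_elem A Q a x) a (Ident A a))"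
  have t_apply: "t a x = w a (yoneda_elem A Q a x) a (Ident A a)" if "a \<in> Obj A" "x \<in> ob Q a" for a x
    using that by (simp add: t_def)
  have we: "w a (yoneda_elem A Q a x) \<in> nat_trans A set_cat (hom_func A a) P"
    if "a \<in> Obj A" "x \<in> ob Q a" for a x
    using that by (intro w yoneda_elem_in[OF ls Q])
  \<comment> \<open>The transformation \<open>w a (yoneda_elem A Q a x)\<close> records the values
    of \<open>t\<close> at all translates of \<open>x\<close>; the naturality of \<open>t\<close> is
    read off from it.\<close>
  have t_shift: "t c (ar Q a c g x) = w a (yoneda_elem A Q a x) c g"
    if "a \<in> Obj A" "c \<in> Obj A" "g \<in> Hom A a c" "x \<in> ob Q a" for a c g x
  proof -
    have "t c (ar Q a c g x) = Comp ?F (hom_func A c) (hom_func A a) P (w a (yoneda_elem A Q a x))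
        (ar (yoneda A) a c g) c (Ident A c)"
      using that by (simp add: t_apply set_functor_simps[OF Q] shift wnat yoneda_elem_in[OF ls Q]
          del: func_cat_simps(4) yoneda_simps(2))
    also have "\<dots> = w a (yoneda_elem A Q a x) c g"
      using that cat by (simp add: func_set_comp_apply del: func_cat_simps(4))
    finally show ?thesis .
  qed
  have t: "t \<in> nat_trans A set_cat Q P"
  proof (rule nat_setI[OF Q P])
    show "t b (ar Q a b f x) = ar P a b f (t a x)"
      if "a \<in> Obj A" "b \<in> Obj A" "f \<in> Hom A a b" "x \<in> ob Q a" for a b f x
      using nat_hom_apply[OF cat we[OF that(1,4)] that(1-3)] that by (simp add: t_shift t_apply)
    show "t a \<in> ob Q a \<rightarrow>\<^sub>E ob P a" if "a \<in> Obj A" for a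
      using nat_set_in[OF we[OF that] that] that cat by (auto simp: t_def)
  qed (simp add: t_def)
  show "\<exists>!t. t \<in> Hom ?E P Q \<and> (\<forall>a\<in>Obj A. \<forall>v\<in>Hom ?E Q (ob (yoneda A) a).
      Comp ?E P Q (ob (yoneda A) a) v t = w a v)"
  proof (rule ex1I[of _ t], intro conjI ballI)
    show "t \<in> Hom ?E P Q"
      using t by simp
    fix a v assume a: "a \<in> Obj A" and "v \<in> Hom ?E Q (ob (yoneda A) a)"
    then have v: "v \<in> nat_trans A set_cat (hom_func A a) Q"
      by simp
    have "Comp ?F (hom_func A a) Q P t v = w a v"
    proof (rule nat_hom_eq[OF cat _ w[OF a v] a])
      show "Comp ?F (hom_func A a) Q P t v \<in> nat_trans A set_cat (hom_func A a) P"
        using category_comp[of ?F "hom_func A a" Q P v t] hom_func_functor[OF ls a] P Q t v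
        by (simp del: func_cat_simps(4))
      have "v a (Ident A a) \<in> ob Q a"
        using nat_set_in[OF v a] a cat by simp
      then show "Comp ?F (hom_func A a) Q P t v a (Ident A a) = w a v a (Ident A a)"
        using a cat nat_hom_eq_yoneda_elem[OF ls Q a v]
        by (simp add: func_set_comp_apply t_apply del: func_cat_simps(4))
    qed
    then show "Comp ?E P Q (ob (yoneda A) a) v t = w a v"
      by (simp del: func_cat_simps(4))
  next
    fix s assume "s \<in> Hom ?E P Q \<and> (\<forall>a\<in>Obj A. \<forall>v\<in>Hom ?E Q (ob (yoneda A) a).
      Comp ?E P Q (ob (yoneda A) a) v s = w a v)"
    then have s: "s \<in> nat_trans A set_cat Q P"
      and sw: "\<And>a v. a \<in> Obj A \<Longrightarrow> v \<in> nat_trans A set_cat (hom_func A a) Q \<Longrightarrow>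
        Comp ?F (hom_func A a) Q P s v = w a v"
      by (simp_all del: func_cat_simps(4))
    show "s = t"
    proof (rule nat_set_ext[OF s t])
      fix a x assume a: "a \<in> Obj A" and x: "x \<in> ob Q a"
      have "w a (yoneda_elem A Q a x) a (Ident A a) = s a (yoneda_elem A Q a x a (Ident A a))"
        unfolding sw[OF a yoneda_elem_in[OF ls Q a x], symmetric]
        using a cat by (simp add: func_set_comp_apply del: func_cat_simps(4))
      then show "s a x = t a x"
        using a x by (simp add: t_apply yoneda_elem_ident[OF cat Q])
    qed
  qed
qed

text \<open>Two applications of the Yoneda lemma: transformations from \<open>B(G a, -)\<close> to
  \<open>S\<close> and from \<open>A(a, -)\<close> to \<open>S \<odot> G\<close> both correspond to
  elements of \<open>S (G a)\<close>. The unit is the action of \<open>G\<close> because it has to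
  send the identity of \<open>a\<close> to the identity of \<open>G a\<close>.\<close>

lemma representable_left_kan:
  assumes lsA: "locally_small A" and lsB: "locally_small B" and G: "is_functor A B G"
    and a: "a \<in> Obj A"
  shows "universal_arrow (func_cat B set_cat) (func_cat A set_cat) (precomp A G)
    (hom_func A a) (hom_func B (ob G a)) (\<lambda>c\<in>Obj A. \<lambda>f\<in>Hom A a c. ar G a c f)"
  unfolding universal_arrow_def
proof (intro conjI ballI)
  let ?\<delta> = "\<lambda>c\<in>Obj A. \<lambda>f\<in>Hom A a c. ar G a c f"
  note Gs = functor_simps[OF G] and cat = functor_category[OF G]
  have ya: "is_functor A set_cat (hom_func A a)" and yb: "is_functor B set_cat (hom_func B (ob G a))"
    using hom_func_functor[OF lsA a] hom_func_functor[OF lsB] Gs(1)[OF a] by auto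
  show "hom_func B (ob G a) \<in> Obj (func_cat B set_cat)"
    using yb by simp
  show "?\<delta> \<in> Hom (func_cat A set_cat) (hom_func A a) (ob (precomp A G) (hom_func B (ob G a)))"
    using a cat by (simp, intro nat_setI[OF ya functor_comp[OF G yb]]) (auto simp: Gs)
  fix S \<sigma> assume "S \<in> Obj (func_cat B set_cat)"
    and "\<sigma> \<in> Hom (func_cat A set_cat) (hom_func A a) (ob (precomp A G) S)"
  then have S: "is_functor B set_cat S" and \<sigma>: "\<sigma> \<in> nat_trans A set_cat (hom_func A a) (S \<odot> G)"
    by simp_all
  let ?x = "\<sigma> a (Ident A a)" and ?Ga = "ob G a"
  have x: "?x \<in> ob S ?Ga"
    using nat_set_in[OF \<sigma> a] a cat by simp
  have SG: "is_functor A set_cat (S \<odot> G)"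
    by (rule functor_comp[OF G S])
  \<comment> \<open>Transformations out of \<open>A(a, -)\<close> are compared at the identity of
    \<open>a\<close>, which turns the factorization condition into a condition on one
    element.\<close>
  have \<tau>\<sigma>: "Comp (func_cat A set_cat) (hom_func A a) (hom_func B ?Ga \<odot> G) (S \<odot> G) (whisker_right A \<tau> G) ?\<delta> = \<sigma>
      \<longleftrightarrow> \<tau> ?Ga (Ident B ?Ga) = ?x"
    if \<tau>: "\<tau> \<in> nat_trans B set_cat (hom_func B ?Ga) S" for \<tau>
  proof -
    let ?c = "Comp (func_cat A set_cat) (hom_func A a) (hom_func B ?Ga \<odot> G) (S \<odot> G) (whisker_right A \<tau> G) ?\<delta>"
    have c: "?c \<in> nat_trans A set_cat (hom_func A a) (S \<odot> G)"
      using category_comp[of "func_cat A set_cat" "hom_func A a" "hom_func B ?Ga \<odot> G" "S \<odot> G"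
          ?\<delta> "whisker_right A \<tau> G"]
        whisker_right_nat_trans[OF G \<tau>] ya functor_comp[OF G yb] SG
        \<open>?\<delta> \<in> Hom (func_cat A set_cat) (hom_func A a) (ob (precomp A G) (hom_func B (ob G a)))\<close>
      by (simp del: func_cat_simps(4))
    have eq: "?c a (Ident A a) = \<tau> ?Ga (Ident B ?Ga)"
      using a cat by (simp add: func_set_comp_apply whisker_right_def Gs del: func_cat_simps(4))
    then show ?thesis
      unfolding eq[symmetric] using nat_hom_eq[OF cat(1) c \<sigma> a] by (intro iffI) (simp only:, blast)
  qed
  have Ga: "?Ga \<in> Obj B"
    using Gs(1)[OF a] .
  have "\<exists>!\<tau>. \<tau> \<in> nat_trans B set_cat (hom_func B ?Ga) S \<and> \<tau> ?Ga (Ident B ?Ga) = ?x"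
    using yoneda_elem_in[OF lsB S Ga x] yoneda_elem_ident[OF cat(2) S Ga x]
      nat_hom_eq[OF cat(2) _ _ Ga, of _ S] by metis
  then show "\<exists>!\<tau>. \<tau> \<in> Hom (func_cat B set_cat) (hom_func B (ob G a)) S \<and>
      Comp (func_cat A set_cat) (hom_func A a) (ob (precomp A G) (hom_func B (ob G a)))
        (ob (precomp A G) S) (ar (precomp A G) (hom_func B (ob G a)) S \<tau>) ?\<delta> = \<sigma>"
    using \<tau>\<sigma> by (simp del: func_cat_simps(4) cong: conj_cong)
qed

section \<open>Formal limits\<close>

lemma full_subcat_op_full_subcat:
  "full_subcat (op_cat (full_subcat C P)) Q = full_subcat (op_cat C) (\<lambda>x. P x \<and> Q x)"
  by (simp add: full_subcat_def op_cat_def)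

lemma op_small_func_cat:
  "op_cat (small_func_cat A) = full_subcat (op_cat (func_cat A set_cat)) (small_functor A)"
  by (simp add: small_func_cat_def full_subcat_def op_cat_def)

text \<open>Merges the two nested full subcategories in \<open>pro\<close> into one predicate, so
  that the results on arbitrary full subcategories of \<open>op_cat (func_cat A set_cat)\<close>
  apply.\<close>

definition pro_object :: "('u, 'u) cat set \<Rightarrow> ('a, 'u) cat \<Rightarrow> ('a, 'u, 'u set, 'u \<Rightarrow> 'u) func \<Rightarrow> bool" where
  "pro_object \<DD> A P \<longleftrightarrow> small_functor A P \<and> (\<exists>I\<in>\<DD>. \<exists>E \<pi>. is_functor (op_cat I) A E \<and>
     is_limit (op_cat I) (op_cat (small_func_cat A)) (yoneda A \<odot> E) P \<pi>)"

lemma pro_eq: "pro \<DD> A = full_subcat (op_cat (func_cat A set_cat)) (pro_object \<DD> A)"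
  unfolding pro_def pro_object_def small_func_cat_def
  by (simp add: full_subcat_op_full_subcat)

lemma terminal_cat_limit:
  assumes J: "terminal_cat J" and E: "is_functor J C E" and j: "j \<in> Obj J"
  shows "is_limit J C E (ob E j) (\<lambda>i\<in>Obj J. Ident C (ob E j))"
proof -
  note cat = functor_category[OF E] and Es = functor_simps[OF E]
  obtain i where J': "Obj J = {j}" "Hom J j j = {i}"
    using J j unfolding terminal_cat_def by fastforce
  have "i = Ident J j"
    using category_ident[OF cat(1) j] J' by simp
  then have "ar E j j i = Ident C (ob E j)"
    using Es(3)[OF j] by simp
  then show ?thesis
    unfolding is_limit_def cones_def
    using E j J' cat Es(1)[OF j] by (auto simp: PiE_iff)
qed

text \<open>A representable is the limit of the diagram on the terminal category that picks its
  object. The argument is run twice, as smallness refers to limits among all functors and membership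
  in \<open>pro\<close> to limits among small ones.\<close>

lemma hom_func_pro_object:
  assumes T: "T \<in> \<DD>" "terminal_cat T" "small_cat T" and ls: "locally_small A" and a: "a \<in> Obj A"
  shows "pro_object \<DD> A (hom_func A a)"
proof -
  have cat: "category A" "category T"
    using ls T(2) by (simp_all add: locally_small_def terminal_cat_def)
  obtain j where j: "j \<in> Obj T"
    using T(2) by (auto simp: terminal_cat_def)
  have T': "terminal_cat (op_cat T)"
    using T(2) by (simp add: terminal_cat_def)
  \<comment> \<open>Needed for every \<open>c\<close>, as the Yoneda embedding must land in small
    functors before the second limit can be stated.\<close>
  have small: "small_functor A (hom_func A c)" if c: "c \<in> Obj A" for c
  proof -
    let ?E = "\<lparr>ob = \<lambda>_. c, ar = \<lambda>_ _ _. Ident A c\<rparr>"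
    have E: "is_functor (op_cat T) A ?E"
      using c cat by (simp add: is_functor_def)
    show ?thesis
      unfolding small_functor_def
      using T(3) E terminal_cat_limit[OF T' functor_comp[OF E yoneda_functor_op[OF ls]], of j] j by auto
  qed
  let ?E = "\<lparr>ob = \<lambda>_. a, ar = \<lambda>_ _ _. Ident A a\<rparr>"
  have E: "is_functor (op_cat T) A ?E"
    using a cat by (simp add: is_functor_def)
  have y: "is_functor A (op_cat (small_func_cat A)) (yoneda A)"
    unfolding op_small_func_cat using yoneda_functor[of A "small_functor A"] ls small by blast
  show ?thesis
    unfolding pro_object_def
    using T(1) E small[OF a] terminal_cat_limit[OF T' functor_comp[OF E y], of j] j by auto
qed

text \<open>A formal limit is coreflected onto the actual limit.\<close>

lemma fully_faithful_limit_couniversal: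
  assumes y: "is_functor B S y"
    and ff: "\<And>a b. a \<in> Obj B \<Longrightarrow> b \<in> Obj B \<Longrightarrow> bij_betw (ar y a b) (Hom B a b) (Hom S (ob y a) (ob y b))"
    and P: "is_limit J S (y \<odot> E) P \<pi>" and X: "is_limit J B E X l"
  shows "\<exists>e\<in>Hom S (ob y X) P. \<forall>c\<in>Obj B. \<forall>f\<in>Hom S (ob y c) P.
    \<exists>!g. g \<in> Hom B c X \<and> Comp S (ob y c) (ob y X) P e (ar y c X g) = f"
proof -
  note ys = functor_simps[OF y] and cat = functor_category[OF y]
  have E: "is_functor J B E"
    using X by (simp add: is_limit_def)
  note Es = functor_simps[OF E]
  have PX: "P \<in> Obj S" "X \<in> Obj B"
    using P X by (simp_all add: is_limit_def)
  have \<pi>: "\<pi> \<in> cones J S (y \<odot> E) P" and l: "l \<in> cones J B E X"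
    using P X by (simp_all add: is_limit_def)
  have \<pi>in: "\<pi> j \<in> Hom S P (ob y (ob E j))" and lin: "l j \<in> Hom B X (ob E j)" if "j \<in> Obj J" for j
    using \<pi> l that by (auto simp: cones_def)
  have \<pi>c: "Comp S P (ob y (ob E i)) (ob y (ob E j)) (ar y (ob E i) (ob E j) (ar E i j h)) (\<pi> i) = \<pi> j"
    and lc: "Comp B X (ob E i) (ob E j) (ar E i j h) (l i) = l j"
    if "i \<in> Obj J" "j \<in> Obj J" "h \<in> Hom J i j" for i j h
    using \<pi> l that by (auto simp: cones_def)
  have limP: "\<exists>!u. u \<in> Hom S Y P \<and> (\<forall>j\<in>Obj J. Comp S Y P (ob y (ob E j)) (\<pi> j) u = \<rho> j)"
    if "Y \<in> Obj S" "\<rho> \<in> cones J S (y \<odot> E) Y" for Y \<rho>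
    using P that by (simp add: is_limit_def)
  have limX: "\<exists>!u. u \<in> Hom B Y X \<and> (\<forall>j\<in>Obj J. Comp B Y X (ob E j) (l j) u = \<rho> j)"
    if "Y \<in> Obj B" "\<rho> \<in> cones J B E Y" for Y \<rho>
    using X that by (simp add: is_limit_def)
  \<comment> \<open>The image of the actual limit cone is a cone over the formal diagram, and
    \<open>e\<close> is its factorization.\<close>
  have "(\<lambda>j\<in>Obj J. ar y X (ob E j) (l j)) \<in> cones J S (y \<odot> E) (ob y X)"
    using PX by (auto simp: cones_def ys Es lin lc simp flip: ys(4))
  from limP[OF ys(1)[OF PX(2)] this] obtain e where e: "e \<in> Hom S (ob y X) P"
    and "\<forall>j\<in>Obj J. Comp S (ob y X) P (ob y (ob E j)) (\<pi> j) e =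
      (\<lambda>j\<in>Obj J. ar y X (ob E j) (l j)) j"
    by blast
  then have \<pi>e: "Comp S (ob y X) P (ob y (ob E j)) (\<pi> j) e = ar y X (ob E j) (l j)" if "j \<in> Obj J" for j
    using that by simp
  have "\<exists>!g. g \<in> Hom B c X \<and> Comp S (ob y c) (ob y X) P e (ar y c X g) = f"
    if c: "c \<in> Obj B" and f: "f \<in> Hom S (ob y c) P" for c f
  proof -
    \<comment> \<open>Fullness lifts the legs of \<open>f\<close> to arrows of \<open>B\<close>;
      faithfulness then makes them a cone over \<open>E\<close>.\<close>
    have "\<exists>r. r \<in> Hom B c (ob E j) \<and> ar y c (ob E j) r = Comp S (ob y c) P (ob y (ob E j)) (\<pi> j) f"
      if j: "j \<in> Obj J" for j
    proof -
      have "Comp S (ob y c) P (ob y (ob E j)) (\<pi> j) f \<in> ar y c (ob E j) ` Hom B c (ob E j)"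
        using ff[OF c Es(1)[OF j]] j c f PX cat by (simp add: bij_betw_def ys Es \<pi>in)
      then show ?thesis
        by auto
    qed
    then obtain r where r: "r j \<in> Hom B c (ob E j)"
        "ar y c (ob E j) (r j) = Comp S (ob y c) P (ob y (ob E j)) (\<pi> j) f" if "j \<in> Obj J" for j
      by metis
    have faithful: "u = v" if "j \<in> Obj J" "u \<in> Hom B c (ob E j)" "v \<in> Hom B c (ob E j)"
        "ar y c (ob E j) u = ar y c (ob E j) v" for u v j
      using ff[OF c Es(1)[OF that(1)]] that(2-4) by (auto simp: bij_betw_def inj_on_def)
    have "Comp B c (ob E i) (ob E j) (ar E i j h) (r i) = r j"
      if *: "i \<in> Obj J" "j \<in> Obj J" "h \<in> Hom J i j" for i j h
    proof (rule faithful[OF *(2)])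
      show "ar y c (ob E j) (Comp B c (ob E i) (ob E j) (ar E i j h) (r i)) = ar y c (ob E j) (r j)"
        using * c f PX cat by (simp add: ys Es r \<pi>in \<pi>c flip: category_assoc)
    qed (use * c cat in \<open>simp_all add: r Es\<close>)
    then have "(\<lambda>j\<in>Obj J. r j) \<in> cones J B E c"
      using r by (auto simp: cones_def)
    then have ex1: "\<exists>!u. u \<in> Hom B c X \<and> (\<forall>j\<in>Obj J. Comp B c X (ob E j) (l j) u = r j)"
      using limX[OF c, of "\<lambda>j\<in>Obj J. r j"] by (simp cong: ball_cong conj_cong)
    have "(\<lambda>j\<in>Obj J. Comp S (ob y c) P (ob y (ob E j)) (\<pi> j) f) \<in> cones J S (y \<odot> E) (ob y c)"
      using c f PX cat by (auto simp: cones_def ys Es \<pi>in \<pi>c simp flip: category_assoc)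
    from limP[OF ys(1)[OF c] this]
    have "\<exists>!u. u \<in> Hom S (ob y c) P \<and> (\<forall>j\<in>Obj J. Comp S (ob y c) P (ob y (ob E j)) (\<pi> j) u =
        Comp S (ob y c) P (ob y (ob E j)) (\<pi> j) f)"
      by (simp cong: ball_cong conj_cong)
    then have monic: "u = f" if "u \<in> Hom S (ob y c) P"
        "\<And>j. j \<in> Obj J \<Longrightarrow> Comp S (ob y c) P (ob y (ob E j)) (\<pi> j) u = Comp S (ob y c) P (ob y (ob E j)) (\<pi> j) f" for u
      using that f by blast
    have comp: "Comp S (ob y c) P (ob y (ob E j)) (\<pi> j) (Comp S (ob y c) (ob y X) P e (ar y c X g)) =
        ar y c (ob E j) (Comp B c X (ob E j) (l j) g)"
      if "j \<in> Obj J" "g \<in> Hom B c X" for j g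
      using that c e PX cat by (simp add: ys Es \<pi>in lin \<pi>e flip: category_assoc)
    \<comment> \<open>Compared leg by leg, \<open>g\<close> factors \<open>f\<close> through
      \<open>e\<close> exactly if it factors the cone \<open>r\<close> through the actual limit, so
      unique existence carries over.\<close>
    have "Comp S (ob y c) (ob y X) P e (ar y c X g) = f \<longleftrightarrow>
        (\<forall>j\<in>Obj J. Comp B c X (ob E j) (l j) g = r j)" if g: "g \<in> Hom B c X" for g
    proof
      assume eq: "Comp S (ob y c) (ob y X) P e (ar y c X g) = f"
      show "\<forall>j\<in>Obj J. Comp B c X (ob E j) (l j) g = r j"
      proof
        fix j assume j: "j \<in> Obj J"
        show "Comp B c X (ob E j) (l j) g = r j"
          by (rule faithful[OF j]) (use g j c PX cat comp[OF j g] eq in \<open>simp_all add: r Es lin\<close>)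
      qed
    next
      assume "\<forall>j\<in>Obj J. Comp B c X (ob E j) (l j) g = r j"
      then show "Comp S (ob y c) (ob y X) P e (ar y c X g) = f"
        using g c e PX cat by (intro monic) (simp_all add: comp ys r)
    qed
    then show ?thesis
      using ex1 by (simp cong: conj_cong)
  qed
  then show ?thesis
    using e by blast
qed

lemma yoneda_pro_functor:
  assumes "T \<in> \<DD>" "terminal_cat T" "small_cat T" "locally_small A"
  shows "is_functor A (pro \<DD> A) (yoneda A)"
  unfolding pro_eq
  using yoneda_functor[of A "pro_object \<DD> A"] hom_func_pro_object[OF assms] assms(4) by blast

lemma pro_right_adjoint_exists:
  assumes T: "T \<in> \<DD>" "terminal_cat T" "small_cat T" and ls: "locally_small B"
    and complete: "D_complete \<DD> B"
  shows "\<exists>L. is_right_adjoint_of B (pro \<DD> B) (yoneda B) L"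
proof (rule right_adjoint_exists[OF yoneda_pro_functor[OF T ls]])
  fix P assume "P \<in> Obj (pro \<DD> B)"
  then have "pro_object \<DD> B P"
    by (simp add: pro_eq)
  then obtain I E \<pi> where I: "I \<in> \<DD>" "is_functor (op_cat I) B E"
    and P: "is_limit (op_cat I) (op_cat (small_func_cat B)) (yoneda B \<odot> E) P \<pi>"
    unfolding pro_object_def by blast
  obtain X l where X: "is_limit (op_cat I) B E X l"
    using complete I unfolding D_complete_def by blast
  \<comment> \<open>A formal limit is by definition a limit in the opposite of all small functors,
    so the couniversal arrow is found there. It serves in \<open>pro\<close> as well, since the
    hom-sets and composites are the same.\<close>
  have "is_functor B (op_cat (small_func_cat B)) (yoneda B)"
    using hom_func_pro_object[OF T ls] unfolding op_small_func_cat
    by (intro yoneda_functor[OF ls]) (simp add: pro_object_def)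
  moreover have "bij_betw (ar (yoneda B) a b) (Hom B a b)
      (Hom (op_cat (small_func_cat B)) (ob (yoneda B) a) (ob (yoneda B) b))"
    if "a \<in> Obj B" "b \<in> Obj B" for a b
    using yoneda_fully_faithful[OF ls that] by (simp add: op_small_func_cat del: yoneda_simps(2))
  ultimately have "\<exists>e\<in>Hom (op_cat (small_func_cat B)) (ob (yoneda B) X) P. \<forall>c\<in>Obj B.
      \<forall>f\<in>Hom (op_cat (small_func_cat B)) (ob (yoneda B) c) P. \<exists>!g. g \<in> Hom B c X \<and>
        Comp (op_cat (small_func_cat B)) (ob (yoneda B) c) (ob (yoneda B) X) P e (ar (yoneda B) c X g) = f"
    by (rule fully_faithful_limit_couniversal[OF _ _ P X])
  moreover have "X \<in> Obj B"
    using X by (simp add: is_limit_def)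
  moreover have "Hom (pro \<DD> B) = Hom (op_cat (small_func_cat B))"
    "Comp (pro \<DD> B) = Comp (op_cat (small_func_cat B))"
    by (simp_all add: pro_eq op_small_func_cat)
  ultimately show "\<exists>c e. c \<in> Obj B \<and> e \<in> Hom (pro \<DD> B) (ob (yoneda B) c) P \<and>
      (\<forall>c'\<in>Obj B. \<forall>f\<in>Hom (pro \<DD> B) (ob (yoneda B) c') P. \<exists>!g. g \<in> Hom B c' c \<and>
        Comp (pro \<DD> B) (ob (yoneda B) c') (ob (yoneda B) c) P e (ar (yoneda B) c' c g) = f)"
    by auto
qed

section \<open>The functor Pro(D, G): independence of choices and restriction to
  representables\<close>

lemma nat_iso_pro: "nat_iso J (op_cat (func_cat A set_cat)) = nat_iso J (pro \<DD> A)"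
  by (simp add: pro_eq)

lemma functor_pro_op:
  "is_functor J (pro \<DD> A) F \<Longrightarrow> is_functor J (op_cat (func_cat A set_cat)) F"
  by (rule functor_full_subcat[of _ _ "pro_object \<DD> A"]) (simp_all flip: pro_eq)

text \<open>The units \<open>\<gamma> P\<close> and \<open>\<kappa> P\<close> are universal arrows
  from the same \<open>P\<close>, and the action of each functor is tied to its units. This carries
  the left adjoint, given for one choice of Pro(D, G), over to every other choice.\<close>

lemma pro_func_nat_iso:
  assumes G: "is_functor A B G" and H: "is_pro_func \<DD> A B G H" and K: "is_pro_func \<DD> A B G K"
  shows "\<exists>\<tau> \<sigma>. nat_iso (pro \<DD> A) (pro \<DD> B) H K \<tau> \<sigma>"
proof -
  obtain \<gamma> where \<gamma>: "\<And>P. P \<in> Obj (pro \<DD> A) \<Longrightarrow> is_left_kan A B set_cat G P (ob H P) (\<gamma> P)"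
    "\<And>P Q \<tau>. P \<in> Obj (pro \<DD> A) \<Longrightarrow> Q \<in> Obj (pro \<DD> A) \<Longrightarrow> \<tau> \<in> Hom (pro \<DD> A) P Q \<Longrightarrow>
       Comp (func_cat A set_cat) Q P (ob H P \<odot> G) (\<gamma> P) \<tau> =
       Comp (func_cat A set_cat) Q (ob H Q \<odot> G) (ob H P \<odot> G) (whisker_right A (ar H P Q \<tau>) G) (\<gamma> Q)"
    using H unfolding is_pro_func_def by blast
  obtain \<kappa> where \<kappa>: "\<And>P. P \<in> Obj (pro \<DD> A) \<Longrightarrow> is_left_kan A B set_cat G P (ob K P) (\<kappa> P)"
    "\<And>P Q \<tau>. P \<in> Obj (pro \<DD> A) \<Longrightarrow> Q \<in> Obj (pro \<DD> A) \<Longrightarrow> \<tau> \<in> Hom (pro \<DD> A) P Q \<Longrightarrow>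
       Comp (func_cat A set_cat) Q P (ob K P \<odot> G) (\<kappa> P) \<tau> =
       Comp (func_cat A set_cat) Q (ob K Q \<odot> G) (ob K P \<odot> G) (whisker_right A (ar K P Q \<tau>) G) (\<kappa> Q)"
    using K unfolding is_pro_func_def by blast
  have HK: "is_functor (pro \<DD> A) (pro \<DD> B) H" "is_functor (pro \<DD> A) (pro \<DD> B) K"
    using H K by (simp_all add: is_pro_func_def)
  \<comment> \<open>Here \<open>id_func\<close> is the inclusion of \<open>pro \<DD> A\<close> into
    the opposite of the functor category.\<close>
  have "is_functor (pro \<DD> A) (op_cat (func_cat A set_cat)) id_func"
    by (intro functor_pro_op[of _ \<DD>] functor_id) (simp add: pro_eq)
  then have "\<exists>\<tau> \<sigma>. nat_iso (pro \<DD> A) (op_cat (func_cat B set_cat)) H K \<tau> \<sigma>"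
    by (rule universal_arrows_nat_iso[OF precomp_functor[OF G] _ functor_pro_op[OF HK(1)]
          functor_pro_op[OF HK(2)], where \<gamma> = \<gamma> and \<delta> = \<kappa>])
      (simp_all add: \<gamma> \<kappa> left_kan_universal_arrow del: func_cat_simps(4))
  then show ?thesis
    by (simp add: nat_iso_pro[of _ _ \<DD>])
qed

text \<open>On the representable of \<open>a\<close>, \<open>\<gamma>\<close> and
  \<open>?\<delta> a\<close> are two universal arrows from the same functor, and both are natural in
  \<open>a\<close>.\<close>

lemma pro_func_yoneda_nat_iso:
  assumes T: "T \<in> \<DD>" "terminal_cat T" "small_cat T" and lsA: "locally_small A"
    and lsB: "locally_small B" and G: "is_functor A B G" and H: "is_pro_func \<DD> A B G H"
  shows "\<exists>\<tau> \<sigma>. nat_iso A (pro \<DD> B) (H \<odot> yoneda A) (yoneda B \<odot> G) \<tau> \<sigma>"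
proof -
  obtain \<gamma> where \<gamma>: "\<And>P. P \<in> Obj (pro \<DD> A) \<Longrightarrow> is_left_kan A B set_cat G P (ob H P) (\<gamma> P)"
    "\<And>P Q \<tau>. P \<in> Obj (pro \<DD> A) \<Longrightarrow> Q \<in> Obj (pro \<DD> A) \<Longrightarrow> \<tau> \<in> Hom (pro \<DD> A) P Q \<Longrightarrow>
       Comp (func_cat A set_cat) Q P (ob H P \<odot> G) (\<gamma> P) \<tau> =
       Comp (func_cat A set_cat) Q (ob H Q \<odot> G) (ob H P \<odot> G) (whisker_right A (ar H P Q \<tau>) G) (\<gamma> Q)"
    using H unfolding is_pro_func_def by blast
  have HF: "is_functor (pro \<DD> A) (pro \<DD> B) H"
    using H by (simp add: is_pro_func_def)
  note yA = yoneda_pro_functor[OF T lsA] and yB = yoneda_pro_functor[OF T lsB]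
  note Gs = functor_simps[OF G] and cat = functor_category[OF G]
  let ?\<delta> = "\<lambda>a. \<lambda>c\<in>Obj A. \<lambda>f\<in>Hom A a c. ar G a c f"
  \<comment> \<open>Naturality of \<open>?\<delta>\<close> in \<open>a\<close> is the preservation
    of composites by \<open>G\<close>.\<close>
  have \<delta>: "Comp (func_cat A set_cat) (hom_func A b) (hom_func A a) (hom_func B (ob G a) \<odot> G)
        (?\<delta> a) (ar (yoneda A) a b f) =
      Comp (func_cat A set_cat) (hom_func A b) (hom_func B (ob G b) \<odot> G) (hom_func B (ob G a) \<odot> G)
        (whisker_right A (ar (yoneda B) (ob G a) (ob G b) (ar G a b f)) G) (?\<delta> b)"
    if "a \<in> Obj A" "b \<in> Obj A" "f \<in> Hom A a b" for a b f
    using that cat by (auto simp: whisker_right_def compose_def Gs fun_eq_iff)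
  have "\<exists>\<tau> \<sigma>. nat_iso A (op_cat (func_cat B set_cat)) (H \<odot> yoneda A) (yoneda B \<odot> G) \<tau> \<sigma>"
    by (rule universal_arrows_nat_iso[OF precomp_functor[OF G] functor_pro_op[OF yA]
          functor_pro_op[OF functor_comp[OF yA HF]] functor_pro_op[OF functor_comp[OF G yB]],
          where \<gamma> = "\<lambda>a. \<gamma> (hom_func A a)" and \<delta> = ?\<delta>])
      (use functor_simps(1,2)[OF yA] in \<open>simp_all add: \<gamma> \<delta> left_kan_universal_arrow
        representable_left_kan[OF lsA lsB G] del: func_cat_simps(4) yoneda_simps(2)\<close>)
  then show ?thesis
    by (simp add: nat_iso_pro[of _ _ \<DD>])
qed

lemma id_comp_func: "id_func \<odot> F = F"
  by (simp add: comp_func_def id_func_def)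

text \<open>\<open>L\<close> is applied to the previous isomorphism; then
  \<open>L \<odot> yoneda B\<close> is removed by the inverse of the unit, which exists because the
  Yoneda embedding is fully faithful.\<close>

lemma pro_composite_yoneda_nat_iso:
  assumes T: "T \<in> \<DD>" "terminal_cat T" "small_cat T" and lsA: "locally_small A"
    and lsB: "locally_small B" and G: "is_functor A B G" and H: "is_pro_func \<DD> A B G H"
    and L: "is_right_adjoint_of B (pro \<DD> B) (yoneda B) L"
  shows "\<exists>\<theta> \<theta>'. nat_iso A B ((L \<odot> H) \<odot> yoneda A) G \<theta> \<theta>'"
proof -
  obtain \<eta> \<epsilon> where adj: "adjunction B (pro \<DD> B) (yoneda B) L \<eta> \<epsilon>"
    using L unfolding is_right_adjoint_of_def by blast
  have HF: "is_functor (pro \<DD> A) (pro \<DD> B) H"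
    using H by (simp add: is_pro_func_def)
  note yA = yoneda_pro_functor[OF T lsA] and yB = yoneda_pro_functor[OF T lsB]
    and LF = adjunctionD(2)[OF adj]
  obtain \<tau> \<sigma> where "nat_iso A (pro \<DD> B) (H \<odot> yoneda A) (yoneda B \<odot> G) \<tau> \<sigma>"
    using pro_func_yoneda_nat_iso[OF T lsA lsB G H] by blast
  from nat_iso_whisker_left[OF LF functor_comp[OF yA HF] functor_comp[OF G yB] this]
  obtain \<tau>' \<sigma>' where 1: "nat_iso A B (L \<odot> H \<odot> yoneda A) (L \<odot> yoneda B \<odot> G) \<tau>' \<sigma>'"
    by blast
  obtain \<kappa> where "nat_iso B B id_func (L \<odot> yoneda B) \<eta> \<kappa>"
    using fully_faithful_unit_iso[OF adj] yoneda_fully_faithful[OF lsB]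
    by (auto simp: pro_eq simp del: yoneda_simps(2))
  from nat_iso_sym[OF nat_iso_whisker_right[OF G this]]
  have "nat_iso A B (L \<odot> yoneda B \<odot> G) G (whisker_right A \<kappa> G) (whisker_right A \<eta> G)"
    by (simp add: id_comp_func comp_func_assoc)
  from nat_iso_trans[OF functor_comp[OF functor_comp[OF yA HF] LF]
      functor_comp[OF functor_comp[OF G yB] LF] G 1 this]
  show ?thesis
    by (simp add: comp_func_assoc)
qed

text \<open>Let \<open>K\<close> be the choice of Pro(D, G) known to have a left adjoint
  \<open>F\<close>. The universal arrow at \<open>b\<close> lives on \<open>F (yoneda B b)\<close>:
  the unit for \<open>K\<close> at the representable, transported to \<open>H\<close>, is composed
  with the unit for \<open>L\<close>.\<close>

lemma pro_composite_right_adjoint: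
  assumes G: "is_functor A B G" and H: "is_pro_func \<DD> A B G H"
    and adj: "right_pro_adjoint \<DD> A B G" and L: "is_right_adjoint_of B (pro \<DD> B) (yoneda B) L"
  shows "is_right_adjoint B (pro \<DD> A) (L \<odot> H)"
proof (rule left_adjoint_exists)
  obtain K F \<eta> \<epsilon> where K: "is_pro_func \<DD> A B G K" and FK: "adjunction (pro \<DD> B) (pro \<DD> A) F K \<eta> \<epsilon>"
    using adj unfolding right_pro_adjoint_def is_right_adjoint_def is_right_adjoint_of_def by blast
  obtain \<eta>' \<epsilon>' where yL: "adjunction B (pro \<DD> B) (yoneda B) L \<eta>' \<epsilon>'"
    using L unfolding is_right_adjoint_of_def by blast
  obtain \<tau> \<sigma> where iso: "nat_iso (pro \<DD> A) (pro \<DD> B) K H \<tau> \<sigma>"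
    using pro_func_nat_iso[OF G K H] by blast
  have HF: "is_functor (pro \<DD> A) (pro \<DD> B) H"
    using H by (simp add: is_pro_func_def)
  note LF = adjunctionD(2)[OF yL] and KF = adjunctionD(2)[OF FK]
  show "is_functor (pro \<DD> A) B (L \<odot> H)"
    by (rule functor_comp[OF HF LF])
  fix b assume b: "b \<in> Obj B"
  have yb: "ob (yoneda B) b \<in> Obj (pro \<DD> B)"
    by (rule functor_simps(1)[OF adjunctionD(1)[OF yL] b])
  show "\<exists>P u. universal_arrow (pro \<DD> A) B (L \<odot> H) b P u"
    using universal_arrow_comp[OF LF HF b adjunction_universal[OF yL b]
        universal_arrow_iso[OF KF HF iso yb adjunction_universal[OF FK yb]]] by blast
qed

text \<open>The last conjunct quantifies over all choices of \<open>H\<close>, \<open>L\<close> and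
  adjunction data, as each is determined only up to isomorphism. It is not vacuous: the second
  conjunct provides \<open>L\<close>, the pro-adjointness hypothesis provides \<open>H\<close>, and
  \<open>L \<odot> H\<close> is asserted to have a left adjoint.\<close>

theorem proposition2p19:
  fixes \<DD> :: "('u, 'u) cat set"
    and A :: "('a, 'u) cat"
    and B :: "('b, 'u) cat"
    and G :: "('a, 'u, 'b, 'u) func"
  assumes "universe TYPE('u)"
    and "\<forall>I\<in>\<DD>. small_cat I"
    and "\<exists>T\<in>\<DD>. terminal_cat T"
    and "locally_small A"
    and "locally_small B"
    and "is_functor A B G"
    and "right_pro_adjoint \<DD> A B G"
    and "D_complete \<DD> B"
  shows "(\<exists>R \<eta> \<mu>. is_codensity_monad A B G R \<eta> \<mu>) \<and>
    (\<exists>L. is_right_adjoint_of B (pro \<DD> B) (yoneda B) L) \<and>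
    (\<forall>H L. is_pro_func \<DD> A B G H \<longrightarrow> is_right_adjoint_of B (pro \<DD> B) (yoneda B) L \<longrightarrow>
       is_right_adjoint B (pro \<DD> A) (L \<odot> H) \<and>
       (\<forall>F \<eta> \<epsilon>. adjunction B (pro \<DD> A) F (L \<odot> H) \<eta> \<epsilon> \<longrightarrow>
          is_codensity_monad A B G (L \<odot> H \<odot> F) \<eta> (induced_mult B F (L \<odot> H) \<epsilon>)))"
proof -
  obtain T where T: "T \<in> \<DD>" "terminal_cat T" "small_cat T"
    using assms(2,3) by blast
  have codensity: "is_codensity_monad A B G (L \<odot> H \<odot> F) \<eta> (induced_mult B F (L \<odot> H) \<epsilon>)"
    if H: "is_pro_func \<DD> A B G H" and L: "is_right_adjoint_of B (pro \<DD> B) (yoneda B) L"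
      and adj: "adjunction B (pro \<DD> A) F (L \<odot> H) \<eta> \<epsilon>" for H L F \<eta> \<epsilon>
  proof -
    have "codense A (pro \<DD> A) (yoneda A)"
      unfolding pro_eq using yoneda_codense[of A "pro_object \<DD> A"] hom_func_pro_object[OF T assms(4)] assms(4)
      by blast
    moreover obtain \<theta> \<theta>' where "nat_iso A B ((L \<odot> H) \<odot> yoneda A) G \<theta> \<theta>'"
      using pro_composite_yoneda_nat_iso[OF T assms(4-6) H L] by blast
    ultimately have "codense_adjunction A B (pro \<DD> A) F (L \<odot> H) \<eta> \<epsilon> (yoneda A) G \<theta> \<theta>'"
      using adj assms(6) by (simp add: codense_adjunction_def)
    from codense_adjunction.codensity_monad[OF this] show ?thesis
      by (simp add: comp_func_assoc)
  qed
  \<comment> \<open>One concrete choice of all data, to witness the existence of a codensity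
    monad.\<close>
  obtain L where L: "is_right_adjoint_of B (pro \<DD> B) (yoneda B) L"
    using pro_right_adjoint_exists[OF T assms(5,8)] by blast
  obtain H where H: "is_pro_func \<DD> A B G H"
    using assms(7) unfolding right_pro_adjoint_def by blast
  obtain F \<eta> \<epsilon> where "adjunction B (pro \<DD> A) F (L \<odot> H) \<eta> \<epsilon>"
    using pro_composite_right_adjoint[OF assms(6) H assms(7) L]
    unfolding is_right_adjoint_def is_right_adjoint_of_def by blast
  from codensity[OF H L this] show ?thesis
    using L codensity pro_composite_right_adjoint[OF assms(6) _ assms(7)] by blast
qed

end
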